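(* Let $R$ be a nil ring, let $I$ be a two-sided ideal of $R[x]$, and let $\bar I$ be the two-sided ideal of $R$ generated by all coefficients of polynomials belonging to $I$. Then $R[x]/I$ is Jacobson radical if and only if $R[x]/\bar I[x]$ is Jacobson radical.
   Context: Rings are associative but need not have an identity. $R[x]$ is the ring of polynomials in one (central) indeterminate $x$ with coefficients in $R$; for an ideal $M$ of $R$, $M[x]$ is the set of polynomials all of whose coefficients lie in $M$. A ring is nil if each of its elements is nilpotent. A ring $S$ is Jacobson radical if $S=J(S)$, where $J(S)$ is the Jacobson radical of $S$; equivalently, for every $a\in S$ there is $r\in S$ with $a+r+ar=0$. *)

theory Defs
  imports "HOL.Hull" "HOL-Library.Poly_Mapping" "HOL-Algebra.QuotRing"
begin

section \<open>Rings without identity, with explicit carrier\<close>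

text \<open>
  The locale \<open>ring\<close> demands an identity. The record type underneath it and the constructions
  on cosets do not, so they are reused here. The field \<open>one\<close> of the record is a dummy, and no
  definition below refers to it (\<open>Quot\<close> only copies it into the \<open>one\<close> field of the quotient).
\<close>

locale nonunital_ring = abelian_group S for S (structure) +
  assumes mult_closed: "\<lbrakk>a \<in> carrier S; b \<in> carrier S\<rbrakk> \<Longrightarrow> a \<otimes> b \<in> carrier S"
    and mult_assoc: "\<lbrakk>a \<in> carrier S; b \<in> carrier S; c \<in> carrier S\<rbrakk>
      \<Longrightarrow> (a \<otimes> b) \<otimes> c = a \<otimes> (b \<otimes> c)"
    and distrib_right: "\<lbrakk>a \<in> carrier S; b \<in> carrier S; c \<in> carrier S\<rbrakk>
      \<Longrightarrow> (a \<oplus> b) \<otimes> c = a \<otimes> c \<oplus> b \<otimes> c"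
    and distrib_left: "\<lbrakk>a \<in> carrier S; b \<in> carrier S; c \<in> carrier S\<rbrakk>
      \<Longrightarrow> a \<otimes> (b \<oplus> c) = a \<otimes> b \<oplus> a \<otimes> c"

definition right_ideal :: "'a set \<Rightarrow> ('a, 'm) ring_scheme \<Rightarrow> bool" where
  "right_ideal K S \<longleftrightarrow>
     additive_subgroup K S \<and> (\<forall>a\<in>K. \<forall>s\<in>carrier S. a \<otimes>\<^bsub>S\<^esub> s \<in> K)"

definition modular_right_ideal :: "'a set \<Rightarrow> ('a, 'm) ring_scheme \<Rightarrow> bool" where
  "modular_right_ideal K S \<longleftrightarrow>
     right_ideal K S \<and> (\<exists>e\<in>carrier S. \<forall>s\<in>carrier S. s \<ominus>\<^bsub>S\<^esub> e \<otimes>\<^bsub>S\<^esub> s \<in> K)"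

definition maximal_right_ideal :: "'a set \<Rightarrow> ('a, 'm) ring_scheme \<Rightarrow> bool" where
  "maximal_right_ideal K S \<longleftrightarrow>
     right_ideal K S \<and> K \<noteq> carrier S \<and>
     (\<forall>L. right_ideal L S \<and> K \<subseteq> L \<longrightarrow> L = K \<or> L = carrier S)"

text \<open>
  The Jacobson radical of a ring without identity is the intersection of its modular maximal
  right ideals (these are the annihilators of nonzero elements of simple right modules); it is the
  whole ring if there are none.
\<close>

definition jacobson_radical :: "('a, 'm) ring_scheme \<Rightarrow> 'a set" where
  "jacobson_radical S =
     {a \<in> carrier S. \<forall>K. modular_right_ideal K S \<and> maximal_right_ideal K S \<longrightarrow> a \<in> K}"

definition jacobson_radical_ring :: "('a, 'm) ring_scheme \<Rightarrow> bool" where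
  "jacobson_radical_ring S \<longleftrightarrow> carrier S = jacobson_radical S"


section \<open>Ideals, nil rings and polynomials\<close>

text \<open>
  The type class \<open>ring\<close> is that of associative rings, possibly without identity.
  For such a ring \<open>R\<close> the type \<open>nat \<Rightarrow>\<^sub>0 R\<close> with its convolution product is the
  polynomial ring \<open>R[x]\<close>; it is again in this class. (The type \<open>R poly\<close> has a product only for
  commutative \<open>R\<close>.)
\<close>

definition two_sided_ideal :: "'a::ring set \<Rightarrow> bool" where
  "two_sided_ideal I \<longleftrightarrow>
     0 \<in> I \<and> (\<forall>a\<in>I. \<forall>b\<in>I. a - b \<in> I) \<and> (\<forall>a\<in>I. \<forall>r. r * a \<in> I \<and> a * r \<in> I)"

definition type_ring :: "'a::ring ring" where
  "type_ring = \<lparr>carrier = UNIV, monoid.mult = (*), one = 0, ring.zero = 0, add = (+)\<rparr>"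

definition quotient_ring :: "'a::ring set \<Rightarrow> 'a set ring" where
  "quotient_ring I = type_ring Quot I"

text \<open>\<open>spow a n\<close> is the power with exponent \<open>n + 1\<close>; there is no exponent 0 without identity.\<close>

primrec spow :: "'a::ring \<Rightarrow> nat \<Rightarrow> 'a" where
  "spow a 0 = a"
| "spow a (Suc n) = spow a n * a"

definition nilpotent :: "'a::ring \<Rightarrow> bool" where
  "nilpotent a \<longleftrightarrow> (\<exists>n. spow a n = 0)"

definition nil_ring :: "'a::ring itself \<Rightarrow> bool" where
  "nil_ring _ \<longleftrightarrow> (\<forall>a::'a. nilpotent a)"

definition poly_set :: "'a::ring set \<Rightarrow> (nat \<Rightarrow>\<^sub>0 'a) set" where
  "poly_set M = {p. \<forall>n. Poly_Mapping.lookup p n \<in> M}"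

definition coeff_ideal :: "(nat \<Rightarrow>\<^sub>0 'a::ring) set \<Rightarrow> 'a set" where
  "coeff_ideal I = two_sided_ideal hull {Poly_Mapping.lookup p n | p n. p \<in> I}"


section \<open>Consistency of the definitions\<close>

lemma two_sided_ideal_coeff_ideal: "two_sided_ideal (coeff_ideal I)"
  unfolding coeff_ideal_def hull_def by (auto simp: two_sided_ideal_def)

lemma two_sided_ideal_uminus: "two_sided_ideal I \<Longrightarrow> a \<in> I \<Longrightarrow> - a \<in> I"
  unfolding two_sided_ideal_def by (metis diff_0)

lemma two_sided_ideal_add: "two_sided_ideal I \<Longrightarrow> a \<in> I \<Longrightarrow> b \<in> I \<Longrightarrow> a + b \<in> I"
  using two_sided_ideal_uminus[of I b] unfolding two_sided_ideal_def
  by (metis diff_minus_eq_add)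

lemma two_sided_ideal_sum:
  "two_sided_ideal I \<Longrightarrow> (\<And>x. x \<in> A \<Longrightarrow> f x \<in> I) \<Longrightarrow> sum f A \<in> I"
  by (induction A rule: infinite_finite_induct)
     (auto simp: two_sided_ideal_add, auto simp: two_sided_ideal_def)

lemma two_sided_ideal_poly_set:
  assumes "two_sided_ideal M"
  shows "two_sided_ideal (poly_set M)"
proof -
  have z: "0 \<in> M" and l: "\<And>a r. a \<in> M \<Longrightarrow> r * a \<in> M" and r: "\<And>a r. a \<in> M \<Longrightarrow> a * r \<in> M"
    using assms by (auto simp: two_sided_ideal_def)
  have "Poly_Mapping.lookup (q * p) n \<in> M" "Poly_Mapping.lookup (p * q) n \<in> M"
    if "p \<in> poly_set M" for p q n
  proof -
    have p: "Poly_Mapping.lookup p k \<in> M" for k using that by (simp add: poly_set_def)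
    show "Poly_Mapping.lookup (q * p) n \<in> M"
      unfolding lookup_mult Sum_any.expand_set when_def
      by (intro two_sided_ideal_sum[OF assms] l) (simp add: p z)
    show "Poly_Mapping.lookup (p * q) n \<in> M"
      unfolding lookup_mult Sum_any.expand_set
      by (intro two_sided_ideal_sum[OF assms] r p)
  qed
  then show ?thesis
    using assms unfolding two_sided_ideal_def
    by (auto simp: poly_set_def lookup_minus)
qed

lemma type_ring_simps [simp]:
  "carrier type_ring = UNIV" "a \<otimes>\<^bsub>type_ring\<^esub> b = a * b" "a \<oplus>\<^bsub>type_ring\<^esub> b = a + b"
  "\<zero>\<^bsub>type_ring\<^esub> = 0"
  by (simp_all add: type_ring_def)

lemma nonunital_ring_type_ring: "nonunital_ring (type_ring :: 'a::ring ring)"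
proof -
  have "\<exists>y. x + y = 0 \<and> y + x = 0" for x :: 'a
    by (metis add.right_inverse add.left_inverse)
  then have "abelian_group (type_ring :: 'a ring)"
    by (intro abelian_groupI) (auto simp: algebra_simps)
  then show ?thesis
    by (auto simp: nonunital_ring_def nonunital_ring_axioms_def algebra_simps)
qed

context
  fixes I :: "'a::ring set"
  assumes I: "two_sided_ideal I"
begin

private abbreviation coset :: "'a \<Rightarrow> 'a set" where
  "coset a \<equiv> I +>\<^bsub>type_ring\<^esub> a"

private lemma mem_coset: "b \<in> coset a \<longleftrightarrow> b - a \<in> I"
  unfolding a_r_coset_def' by (auto, metis diff_add_cancel)

private lemma coset_eqI:
  assumes "a - b \<in> I" shows "coset a = coset b"
proof -
  have "x - a \<in> I \<longleftrightarrow> x - b \<in> I" for x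
    using two_sided_ideal_add[OF I, of "x - a" "a - b"] assms
      two_sided_ideal_add[OF I, of "x - b" "b - a"] two_sided_ideal_uminus[OF I assms]
    by auto
  then show ?thesis by (auto simp: mem_coset)
qed

lemma coset_eq_iff: "I +>\<^bsub>type_ring\<^esub> a = I +>\<^bsub>type_ring\<^esub> b \<longleftrightarrow> a - b \<in> I"
  using coset_eqI[of a b] mem_coset[of a a] mem_coset[of a b] I
  by (auto simp: two_sided_ideal_def)

lemma quotient_ring_carrier: "carrier (quotient_ring I) = range (\<lambda>a. I +>\<^bsub>type_ring\<^esub> a)"
  by (auto simp: quotient_ring_def FactRing_def A_RCOSETS_def')

lemma quotient_ring_zero: "\<zero>\<^bsub>quotient_ring I\<^esub> = I +>\<^bsub>type_ring\<^esub> 0"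
  by (auto simp: quotient_ring_def FactRing_def mem_coset)

lemma quotient_ring_add:
  "(I +>\<^bsub>type_ring\<^esub> a) \<oplus>\<^bsub>quotient_ring I\<^esub> (I +>\<^bsub>type_ring\<^esub> b) = I +>\<^bsub>type_ring\<^esub> (a + b)"
proof -
  have "x \<in> coset a <+>\<^bsub>type_ring\<^esub> coset b \<longleftrightarrow> x \<in> coset (a + b)" for x
  proof
    assume "x \<in> coset a <+>\<^bsub>type_ring\<^esub> coset b"
    then obtain u v where "x = u + v" "u - a \<in> I" "v - b \<in> I"
      by (auto simp: set_add_def' mem_coset)
    then show "x \<in> coset (a + b)"
      using two_sided_ideal_add[OF I, of "u - a" "v - b"] by (simp add: mem_coset algebra_simps)
  next
    assume "x \<in> coset (a + b)"
    then have "a \<in> coset a" "x - a \<in> coset b" "x = a + (x - a)"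
      using I by (auto simp: mem_coset two_sided_ideal_def algebra_simps)
    then show "x \<in> coset a <+>\<^bsub>type_ring\<^esub> coset b"
      unfolding set_add_def' type_ring_simps by blast
  qed
  then show ?thesis by (auto simp: quotient_ring_def FactRing_def)
qed

lemma quotient_ring_mult:
  "(I +>\<^bsub>type_ring\<^esub> a) \<otimes>\<^bsub>quotient_ring I\<^esub> (I +>\<^bsub>type_ring\<^esub> b) = I +>\<^bsub>type_ring\<^esub> (a * b)"
proof -
  have "coset (u * v) = coset (a * b)" if "u \<in> coset a" "v \<in> coset b" for u v
  proof (rule coset_eqI)
    have "(u - a) * v \<in> I" "a * (v - b) \<in> I"
      using that I by (auto simp: mem_coset two_sided_ideal_def)
    from two_sided_ideal_add[OF I this] show "u * v - a * b \<in> I"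
      by (simp add: algebra_simps)
  qed
  moreover have "a \<in> coset a" "b \<in> coset b"
    using I by (auto simp: mem_coset two_sided_ideal_def)
  ultimately have "(\<Union>u\<in>coset a. \<Union>v\<in>coset b. coset (u * v)) = coset (a * b)"
    by blast
  then show ?thesis
    by (simp add: quotient_ring_def FactRing_def rcoset_mult_def)
qed

lemma nonunital_ring_quotient_ring: "nonunital_ring (quotient_ring I)"
proof -
  have "\<exists>y. coset (y + a) = coset 0" for a
    by (rule exI[of _ "- a"]) simp
  then have "abelian_group (quotient_ring I)"
    by (intro abelian_groupI)
       (auto simp: quotient_ring_carrier quotient_ring_add quotient_ring_zero algebra_simps)
  then show ?thesis
    by (auto simp: nonunital_ring_def nonunital_ring_axioms_def quotient_ring_carrier
        quotient_ring_add quotient_ring_mult algebra_simps)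
qed

end

context nonunital_ring
begin

lemma mult_zero_right: "a \<in> carrier S \<Longrightarrow> a \<otimes> \<zero> = \<zero>"
  using distrib_left[of a \<zero> \<zero>] mult_closed[of a \<zero>]
  by (metis add.l_cancel_one' zero_closed l_zero)

lemma mult_zero_left: "a \<in> carrier S \<Longrightarrow> \<zero> \<otimes> a = \<zero>"
  using distrib_right[of \<zero> \<zero> a] mult_closed[of \<zero> a]
  by (metis add.l_cancel_one' zero_closed l_zero)

lemma mult_minus_right:
  assumes "a \<in> carrier S" "b \<in> carrier S" shows "a \<otimes> (\<ominus> b) = \<ominus> (a \<otimes> b)"
  using distrib_left[of a "\<ominus> b" b] assms mult_closed
  by (metis a_inv_closed l_neg minus_equality mult_zero_right)

lemma mult_minus_left:
  assumes "a \<in> carrier S" "b \<in> carrier S" shows "(\<ominus> a) \<otimes> b = \<ominus> (a \<otimes> b)"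
  using distrib_right[of "\<ominus> a" a b] assms mult_closed
  by (metis a_inv_closed l_neg minus_equality mult_zero_left)

lemma right_ideal_iff:
  "right_ideal K S \<longleftrightarrow> K \<subseteq> carrier S \<and> \<zero> \<in> K \<and> (\<forall>a\<in>K. \<forall>b\<in>K. a \<oplus> b \<in> K) \<and>
     (\<forall>a\<in>K. \<ominus> a \<in> K) \<and> (\<forall>a\<in>K. \<forall>s\<in>carrier S. a \<otimes> s \<in> K)"
  by (auto simp: right_ideal_def additive_subgroup_def subgroup_def a_inv_def)

theorem jacobson_radical_ring_iff_quasi_regular:
  "jacobson_radical_ring S \<longleftrightarrow> (\<forall>a\<in>carrier S. \<exists>r\<in>carrier S. a \<oplus> r \<oplus> a \<otimes> r = \<zero>)"
    (is "_ \<longleftrightarrow> ?qr")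
proof
  assume qr: ?qr
  have False if K: "modular_right_ideal K S" "maximal_right_ideal K S" for K
  proof -
    obtain e where e: "e \<in> carrier S" "\<And>s. s \<in> carrier S \<Longrightarrow> s \<ominus> e \<otimes> s \<in> K"
      using K by (auto simp: modular_right_ideal_def)
    have rK: "right_ideal K S" and ne: "K \<noteq> carrier S"
      using K by (auto simp: maximal_right_ideal_def)
    obtain r where r: "r \<in> carrier S" "\<ominus> e \<oplus> r \<oplus> (\<ominus> e) \<otimes> r = \<zero>"
      using qr e by blast
    have "\<ominus> e \<oplus> (r \<ominus> e \<otimes> r) = \<zero>"
      using r e mult_closed by (simp add: mult_minus_left a_minus_def a_assoc)
    then have "e = r \<ominus> e \<otimes> r"
      using r e mult_closed
      by (metis a_inv_closed add.inv_solve_left minus_closed minus_minus r_zero zero_closed)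
    then have eK: "e \<in> K" using e r by metis
    have "s \<in> K" if s: "s \<in> carrier S" for s
    proof -
      have "e \<otimes> s \<in> K" using rK eK s by (auto simp: right_ideal_iff)
      then have "(s \<ominus> e \<otimes> s) \<oplus> e \<otimes> s \<in> K"
        using e(2)[OF s] rK by (auto simp: right_ideal_iff)
      then show ?thesis
        using s e mult_closed by (simp add: a_minus_def a_assoc l_neg)
    qed
    then show False using rK ne by (auto simp: right_ideal_iff)
  qed
  then show "jacobson_radical_ring S"
    by (auto simp: jacobson_radical_ring_def jacobson_radical_def)
next
  assume J: "jacobson_radical_ring S"
  show ?qr
  proof (rule ccontr)
    assume "\<not> ?qr"
    then obtain a where a: "a \<in> carrier S"
      and no: "\<And>r. r \<in> carrier S \<Longrightarrow> a \<oplus> r \<oplus> a \<otimes> r \<noteq> \<zero>" by blast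
    define K0 where "K0 = (\<lambda>s. s \<oplus> a \<otimes> s) ` carrier S"
    have add: "(s \<oplus> a \<otimes> s) \<oplus> (t \<oplus> a \<otimes> t) = (s \<oplus> t) \<oplus> a \<otimes> (s \<oplus> t)"
      if "s \<in> carrier S" "t \<in> carrier S" for s t
      using that a mult_closed by (simp add: distrib_left a_ac)
    have K0: "right_ideal K0 S"
      unfolding right_ideal_iff
    proof (intro conjI ballI)
      show "K0 \<subseteq> carrier S" using a mult_closed by (auto simp: K0_def)
      show "\<zero> \<in> K0" unfolding K0_def
        by (rule image_eqI[of _ _ \<zero>]) (auto simp: mult_zero_right a)
      show "x \<oplus> y \<in> K0" if "x \<in> K0" "y \<in> K0" for x y
        using that add by (auto simp: K0_def)
      show "\<ominus> x \<in> K0" if x: "x \<in> K0" for x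
      proof -
        obtain t where t: "t \<in> carrier S" "x = t \<oplus> a \<otimes> t" using x by (auto simp: K0_def)
        then have "\<ominus> x = \<ominus> t \<oplus> a \<otimes> (\<ominus> t)"
          using a mult_closed by (simp add: mult_minus_right minus_add)
        then show ?thesis using t by (auto simp: K0_def)
      qed
      show "x \<otimes> s \<in> K0" if x: "x \<in> K0" and s: "s \<in> carrier S" for x s
      proof -
        obtain t where t: "t \<in> carrier S" "x = t \<oplus> a \<otimes> t" using x by (auto simp: K0_def)
        then have "x \<otimes> s = t \<otimes> s \<oplus> a \<otimes> (t \<otimes> s)"
          using a s mult_closed by (simp add: distrib_right mult_assoc)
        then show ?thesis using t s mult_closed by (auto simp: K0_def)
      qed
    qed
    have aK0: "a \<notin> K0"
    proof
      assume "a \<in> K0"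
      then obtain s where s: "s \<in> carrier S" "a = s \<oplus> a \<otimes> s" by (auto simp: K0_def)
      have "a \<oplus> \<ominus> s \<oplus> a \<otimes> (\<ominus> s) = a \<oplus> \<ominus> (s \<oplus> a \<otimes> s)"
        using a s(1) mult_closed by (simp add: mult_minus_right minus_add a_assoc)
      also have "\<dots> = \<zero>" using s(2) a by (metis r_neg)
      finally show False using no[of "\<ominus> s"] s by simp
    qed
    define F where "F = {K. right_ideal K S \<and> K0 \<subseteq> K \<and> a \<notin> K}"
    have "\<exists>M\<in>F. \<forall>X\<in>F. M \<subseteq> X \<longrightarrow> X = M"
    proof (rule subset_Zorn_nonempty)
      show "F \<noteq> {}" using K0 aK0 by (auto simp: F_def)
      fix C assume C: "C \<noteq> {}" "subset.chain F C"
      have CF: "C \<subseteq> F" and lin: "\<And>X Y. X \<in> C \<Longrightarrow> Y \<in> C \<Longrightarrow> X \<subseteq> Y \<or> Y \<subseteq> X"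
        using C by (auto simp: subset.chain_def)
      have "x \<oplus> y \<in> \<Union>C" if xy: "x \<in> \<Union>C" "y \<in> \<Union>C" for x y
      proof -
        obtain X where "X \<in> C" "x \<in> X" "y \<in> X"
          using xy lin by blast
        moreover from this have "right_ideal X S" using CF by (auto simp: F_def)
        ultimately show ?thesis by (auto simp: right_ideal_iff)
      qed
      moreover have rC: "right_ideal X S" if "X \<in> C" for X using that CF by (auto simp: F_def)
      moreover have "\<zero> \<in> \<Union>C" using C(1) rC by (auto simp: right_ideal_iff)
      moreover have "\<Union>C \<subseteq> carrier S" using rC by (intro Union_least) (simp add: right_ideal_iff)
      moreover have "\<ominus> x \<in> \<Union>C" if "x \<in> \<Union>C" for x
        using that rC unfolding right_ideal_iff by (elim UnionE) (intro UnionI, auto)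
      moreover have "x \<otimes> s \<in> \<Union>C" if "x \<in> \<Union>C" "s \<in> carrier S" for x s
        using that rC unfolding right_ideal_iff by (elim UnionE) (intro UnionI, auto)
      ultimately have "right_ideal (\<Union>C) S"
        unfolding right_ideal_iff by (intro conjI ballI) blast+
      then show "\<Union>C \<in> F" using CF C(1) by (auto simp: F_def)
    qed
    then obtain M where M: "right_ideal M S" "K0 \<subseteq> M" "a \<notin> M"
      and mx: "\<And>X. right_ideal X S \<Longrightarrow> a \<notin> X \<Longrightarrow> M \<subseteq> X \<Longrightarrow> X = M"
      by (auto simp: F_def)
    have full: "L = carrier S" if L: "right_ideal L S" "M \<subseteq> L" "a \<in> L" for L
    proof -
      have "s \<in> L" if s: "s \<in> carrier S" for s
      proof -
        have "s \<oplus> a \<otimes> s \<in> L" using s L M by (auto simp: K0_def)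
        moreover have "\<ominus> (a \<otimes> s) \<in> L" using s L by (auto simp: right_ideal_iff)
        ultimately have "s \<oplus> a \<otimes> s \<oplus> \<ominus> (a \<otimes> s) \<in> L" using L by (auto simp: right_ideal_iff)
        then show ?thesis using s a mult_closed by (simp add: a_assoc r_neg)
      qed
      then show ?thesis using L by (auto simp: right_ideal_iff)
    qed
    have "s \<ominus> (\<ominus> a) \<otimes> s \<in> M" if "s \<in> carrier S" for s
      using that M a mult_closed by (auto simp: K0_def a_minus_def mult_minus_left)
    then have "modular_right_ideal M S"
      using M a unfolding modular_right_ideal_def by blast
    moreover have "maximal_right_ideal M S"
      using M a mx full unfolding maximal_right_ideal_def by blast
    ultimately show False
      using J a M(3) by (auto simp: jacobson_radical_ring_def jacobson_radical_def)
  qed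
qed

end

end

theory Submission
  imports Defs
begin

text \<open>
  Write \<open>J\<close> for the ideal \<open>coeff_ideal I\<close> of \<open>R\<close>. As \<open>I\<close> is contained in \<open>J[x]\<close>, quasi-regularity of all
  elements passes from \<open>R[x] / I\<close> to its quotient \<open>R[x] / J[x]\<close>.

  For the converse, suppose that \<open>R[x] / I\<close> is not radical. Then \<open>R[x]\<close> has a modular maximal right
  ideal \<open>K\<close> containing \<open>I\<close>, and \<open>V = R[x] / K\<close> is a simple right module annihilated by \<open>I\<close>. It
  suffices that the coefficients of every polynomial annihilating \<open>V\<close> annihilate \<open>V\<close>
  (\<open>leading_subset_annihilator\<close>): then \<open>V\<close> is annihilated by \<open>J[x]\<close>, and modularity gives
  \<open>J[x] \<subseteq> K\<close>, so \<open>R[x] / J[x]\<close> is not radical either.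

  Suppose therefore that \<open>b x\<^sup>n + \<Sum>i<n. a\<^sub>i x\<^sup>i\<close> annihilates \<open>V\<close> while \<open>b\<close> does not. The \<open>b\<close> of this
  kind, together with those annihilating \<open>V\<close>, form an ideal \<open>B\<close> of \<open>R\<close>, and on \<open>V\<close> a factor from \<open>B\<close>
  lowers the degree in \<open>x\<close>. The element \<open>x\<close> acts
  bijectively on \<open>V\<close>, since otherwise \<open>V\<close> would be a simple module over the nil ring \<open>R\<close>. Let \<open>Y\<close> be the
  inverse of this action. Call an \<open>R\<close>-submodule \<open>E\<close> of \<open>V\<close> dense if every vector is taken into \<open>E\<close> by
  some power of \<open>B\<close>. The main observation is that density is a finitary condition: \<open>E\<close> is dense iff it
  contains \<open>Y\<^sup>q w\<close> for all large \<open>q\<close>, where \<open>w \<noteq> 0\<close> is fixed, and \<open>n + 1\<close> consecutive values of \<open>q\<close> are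
  enough (\<open>dense_Yn\<close>, \<open>dense_if_Yn\<close>). It follows that \<open>w R\<close> is never dense: otherwise \<open>Y\<^sup>p w = w g\<close>
  with \<open>g\<close> nilpotent, and some \<open>Y\<^sup>p\<^sup>j w\<close> vanishes (\<open>not_dense_cyclic\<close>).

  A dense \<open>w R\<close> is now constructed, in analogy with the fact that a direct sum of finitely many copies
  of a simple module of infinite dimension over its endomorphisms is cyclic. Finitariness and Zorn's
  lemma give a submodule \<open>E\<close> maximal among the non-dense ones, so \<open>V / E\<close> is simple up to torsion. The
  submodules \<open>C\<^sub>j\<close> of all \<open>v\<close> with \<open>v x\<^sup>i \<in> E\<close> for \<open>i < j\<close> decrease from \<open>C\<^sub>0 = V\<close> to \<open>C\<^sub>n = 0\<close>. By
  induction on \<open>j\<close> there is \<open>w\<close> with \<open>w R + C\<^sub>j\<close> dense: passing from \<open>j\<close> to \<open>j + 1\<close>, the vector \<open>w\<close> is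
  corrected by an element of \<open>C\<^sub>j\<close> (\<open>dense_cyclic_extend\<close>). There is enough room for this because
  finitely many vectors of \<open>V / E\<close> always have a common annihilator in \<open>R\<close> that does not annihilate
  \<open>V\<close> (\<open>finite_annihilator\<close>), which holds since \<open>R\<close> is nil.
\<close>

section \<open>Simple modules over polynomial rings\<close>

lemma spow_commute: "(a::'a::ring) * spow a n = spow a n * a"
  by (induction n) (simp_all add: mult.assoc[symmetric])

text \<open>
  The situation studied below is that of a simple right module \<open>V\<close> over \<open>R[x]\<close> for a nil
  ring \<open>R\<close>. To work with quotients without a type for them, \<open>V\<close> is given as the group
  \<open>'v\<close> modulo the subgroup \<open>K\<close>: a vector counts as zero if it lies in \<open>K\<close>, and two
  vectors are equal if their difference does. The map \<open>X\<close> is multiplication by \<open>x\<close>.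
  Simplicity is the maximality of \<open>K\<close> together with \<open>V R \<noteq> 0\<close>.
\<close>

locale polynomial_module =
  fixes act :: "'v::ab_group_add \<Rightarrow> 'a::ring \<Rightarrow> 'v" (infixl "\<cdot>" 75)
    and X :: "'v \<Rightarrow> 'v" and K :: "'v set"
  assumes act_add_left: "(u + v) \<cdot> r = u \<cdot> r + v \<cdot> r"
    and act_add_right: "v \<cdot> (r + s) = v \<cdot> r + v \<cdot> s"
    and act_act: "v \<cdot> r \<cdot> s = v \<cdot> (r * s)"
    and X_add: "X (u + v) = X u + X v"
    and X_act: "X (v \<cdot> r) = X v \<cdot> r"
    and K_zero: "0 \<in> K"
    and K_diff: "u \<in> K \<Longrightarrow> v \<in> K \<Longrightarrow> u - v \<in> K"
    and K_act: "v \<in> K \<Longrightarrow> v \<cdot> r \<in> K"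
    and K_X: "v \<in> K \<Longrightarrow> X v \<in> K"
    and K_maximal: "\<lbrakk>K \<subseteq> E; \<And>u v. u \<in> E \<Longrightarrow> v \<in> E \<Longrightarrow> u - v \<in> E;
      \<And>v r. v \<in> E \<Longrightarrow> v \<cdot> r \<in> E; \<And>v. v \<in> E \<Longrightarrow> X v \<in> E\<rbrakk> \<Longrightarrow> E = K \<or> E = UNIV"
    and nondegenerate: "\<exists>v r. v \<cdot> r \<notin> K"
    and nil: "nil_ring TYPE('a)"
begin

text \<open>
  Only the action of \<open>R\<close> is considered here; closure under \<open>X\<close> is stated separately where it holds.
\<close>

definition submodule :: "'v set \<Rightarrow> bool" where
  "submodule E \<longleftrightarrow> K \<subseteq> E \<and> (\<forall>u\<in>E. \<forall>v\<in>E. u - v \<in> E) \<and> (\<forall>v\<in>E. \<forall>r. v \<cdot> r \<in> E)"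

lemma submoduleI:
  assumes "\<And>v. v \<in> K \<Longrightarrow> v \<in> E" "\<And>u v. u \<in> E \<Longrightarrow> v \<in> E \<Longrightarrow> u - v \<in> E"
    "\<And>v r. v \<in> E \<Longrightarrow> v \<cdot> r \<in> E"
  shows "submodule E"
  using assms by (auto simp: submodule_def)

lemma
  assumes "submodule E"
  shows submodule_K: "v \<in> K \<Longrightarrow> v \<in> E"
    and submodule_diff: "u \<in> E \<Longrightarrow> v \<in> E \<Longrightarrow> u - v \<in> E"
    and submodule_act: "v \<in> E \<Longrightarrow> v \<cdot> r \<in> E"
  using assms by (auto simp: submodule_def)

lemma submodule_zero: "submodule E \<Longrightarrow> 0 \<in> E"
  by (rule submodule_K[OF _ K_zero])

lemma submodule_uminus: "submodule E \<Longrightarrow> v \<in> E \<Longrightarrow> - v \<in> E"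
  using submodule_diff[of E 0 v] submodule_zero[of E] by simp

lemma submodule_add: "submodule E \<Longrightarrow> u \<in> E \<Longrightarrow> v \<in> E \<Longrightarrow> u + v \<in> E"
  using submodule_diff[of E u "- v"] submodule_uminus[of E v] by simp

lemma submodule_sum: "submodule E \<Longrightarrow> (\<And>i. i \<in> A \<Longrightarrow> f i \<in> E) \<Longrightarrow> sum f A \<in> E"
  by (induction A rule: infinite_finite_induct) (auto simp: submodule_zero submodule_add)

lemma submodule_cong:
  assumes "submodule E" "u - v \<in> K"
  shows "u \<in> E \<longleftrightarrow> v \<in> E"
proof -
  have "u - v \<in> E" using assms by (rule submodule_K)
  then show ?thesis
    using submodule_add[OF assms(1), of "u - v" v] submodule_diff[OF assms(1), of u "u - v"] by auto
qed

lemma submodule_self: "submodule K"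
  by (intro submoduleI K_diff K_act)

lemma submodule_Inter: "(\<And>F. F \<in> \<F> \<Longrightarrow> submodule F) \<Longrightarrow> submodule (\<Inter>\<F>)"
  by (intro submoduleI) (auto dest: submodule_K submodule_diff submodule_act)

lemma act_zero_left [simp]: "0 \<cdot> r = 0"
  using act_add_left[of 0 0 r] by simp

lemma act_zero_right [simp]: "v \<cdot> 0 = 0"
  using act_add_right[of v 0 0] by simp

lemma act_diff_left: "(u - v) \<cdot> r = u \<cdot> r - v \<cdot> r"
  using act_add_left[of "u - v" v r] by (simp add: eq_diff_eq)

lemma act_diff_right: "v \<cdot> (r - s) = v \<cdot> r - v \<cdot> s"
  using act_add_right[of v "r - s" s] by (simp add: eq_diff_eq)

lemma X_diff: "X (u - v) = X u - X v"
  using X_add[of "u - v" v] by (simp add: eq_diff_eq)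

lemma Xn_diff: "(X ^^ i) (u - v) = (X ^^ i) u - (X ^^ i) v"
  by (induction i) (simp_all add: X_diff)

lemma Xn_zero [simp]: "(X ^^ i) 0 = 0"
  using Xn_diff[of i 0 0] by simp

lemma Xn_add: "(X ^^ i) (u + v) = (X ^^ i) u + (X ^^ i) v"
  by (induction i) (simp_all add: X_add)

lemma Xn_sum: "(X ^^ i) (sum f A) = (\<Sum>a\<in>A. (X ^^ i) (f a))"
  by (induction A rule: infinite_finite_induct) (auto simp: Xn_add)

lemma Xn_act: "(X ^^ i) (v \<cdot> r) = (X ^^ i) v \<cdot> r"
  by (induction i) (simp_all add: X_act)

lemma act_sum: "sum f A \<cdot> r = (\<Sum>a\<in>A. f a \<cdot> r)"
  by (induction A rule: infinite_finite_induct) (auto simp: act_add_left)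

lemma Xn_K: "v \<in> K \<Longrightarrow> (X ^^ i) v \<in> K"
  by (induction i) (simp_all add: K_X)

lemma Xn_X: "(X ^^ i) ((X ^^ j) v) = (X ^^ (i + j)) v"
  by (simp add: funpow_add)

lemma K_add: "u \<in> K \<Longrightarrow> v \<in> K \<Longrightarrow> u + v \<in> K"
  using submodule_add[OF submodule_self] .

lemma submodule_UNIV:
  assumes "submodule E" "\<And>v. v \<in> E \<Longrightarrow> X v \<in> E" "w \<in> E" "w \<notin> K"
  shows "E = UNIV"
  using K_maximal[of E] assms by (auto simp: submodule_def)

lemma act_faithful:
  assumes "w \<notin> K"
  shows "\<exists>r. w \<cdot> r \<notin> K"
proof (rule ccontr)
  assume "\<not> ?thesis"
  then have w: "w \<in> {v. \<forall>r. v \<cdot> r \<in> K}" by simp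
  have "{v. \<forall>r. v \<cdot> r \<in> K} = UNIV"
    by (rule submodule_UNIV[OF _ _ w assms])
      (auto intro!: submoduleI simp: act_diff_left act_act K_diff K_act X_act[symmetric] K_X)
  then show False using nondegenerate by blast
qed

text \<open>
  An induction principle: \<open>w R[x]\<close> is all of \<open>V\<close> for nonzero \<open>w\<close>, so a property that
  cuts out an \<open>R\<close>-submodule holds for all vectors once it holds for the \<open>w x\<^sup>i r\<close>. It
  replaces writing vectors as explicit sums of such elements.
\<close>

lemma generated:
  assumes w: "w \<notin> K" and E: "submodule E" and gen: "\<And>i r. (X ^^ i) (w \<cdot> r) \<in> E"
  shows "E = UNIV"
proof -
  define \<F> where "\<F> = {F. submodule F \<and> (\<forall>i r. (X ^^ i) (w \<cdot> r) \<in> F)}"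
  have sub: "submodule (\<Inter>\<F>)" by (rule submodule_Inter) (simp add: \<F>_def)
  have gen': "(X ^^ i) (w \<cdot> r) \<in> \<Inter>\<F>" for i r by (simp add: \<F>_def)
  \<comment> \<open>The least submodule containing the generators is invariant, since \<open>X\<close> maps generators to generators.\<close>
  have X_closed: "X v \<in> \<Inter>\<F>" if v: "v \<in> \<Inter>\<F>" for v
  proof -
    have "{v \<in> \<Inter>\<F>. X v \<in> \<Inter>\<F>} \<in> \<F>"
      unfolding \<F>_def
    proof (intro CollectI conjI allI)
      show "submodule {v \<in> \<Inter>{F. submodule F \<and> (\<forall>i r. (X ^^ i) (w \<cdot> r) \<in> F)}.
              X v \<in> \<Inter>{F. submodule F \<and> (\<forall>i r. (X ^^ i) (w \<cdot> r) \<in> F)}}"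
        using sub unfolding \<F>_def
        by (intro submoduleI)
          (auto simp: X_diff X_act intro: submodule_K submodule_diff submodule_act K_X)
      show "X ((X ^^ i) (w \<cdot> r)) \<in> \<Inter>{F. submodule F \<and> (\<forall>i r. (X ^^ i) (w \<cdot> r) \<in> F)}" for i r
        using gen'[of "Suc i" r] by (simp add: \<F>_def)
    qed (use gen' in \<open>auto simp: \<F>_def\<close>)
    then show ?thesis using v by blast
  qed
  obtain r where r: "w \<cdot> r \<notin> K" using act_faithful[OF w] by blast
  have "w \<cdot> r \<in> \<Inter>\<F>" using gen'[of 0 r] by simp
  from submodule_UNIV[OF sub X_closed this r] have "\<Inter>\<F> = UNIV" .
  moreover have "E \<in> \<F>" using E gen by (simp add: \<F>_def)
  ultimately show ?thesis by blast
qed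

definition cyclic :: "'v \<Rightarrow> 'v set \<Rightarrow> 'v set" where
  "cyclic w E = {u. \<exists>r. u - w \<cdot> r \<in> E}"

lemma submodule_cyclic:
  assumes E: "submodule E"
  shows "submodule (cyclic w E)"
proof (rule submoduleI)
  show "v \<in> cyclic w E" if "v \<in> K" for v
    using submodule_K[OF E that] by (auto simp: cyclic_def intro: exI[of _ 0])
  show "u - v \<in> cyclic w E" if uv: "u \<in> cyclic w E" "v \<in> cyclic w E" for u v
  proof -
    obtain r s where rs: "u - w \<cdot> r \<in> E" "v - w \<cdot> s \<in> E" using uv by (auto simp: cyclic_def)
    have "(u - v) - w \<cdot> (r - s) = (u - w \<cdot> r) - (v - w \<cdot> s)" by (simp add: act_diff_right)
    then have "(u - v) - w \<cdot> (r - s) \<in> E" using submodule_diff[OF E rs] by metis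
    then show ?thesis unfolding cyclic_def by blast
  qed
  show "v \<cdot> s \<in> cyclic w E" if v: "v \<in> cyclic w E" for v s
  proof -
    obtain r where r: "v - w \<cdot> r \<in> E" using v by (auto simp: cyclic_def)
    have "v \<cdot> s - w \<cdot> (r * s) = (v - w \<cdot> r) \<cdot> s" by (simp add: act_diff_left act_act)
    then have "v \<cdot> s - w \<cdot> (r * s) \<in> E" using submodule_act[OF E r] by metis
    then show ?thesis unfolding cyclic_def by blast
  qed
qed

lemma cyclic_act: "submodule E \<Longrightarrow> w \<cdot> r \<in> cyclic w E"
  by (auto simp: cyclic_def submodule_zero intro: exI[of _ r])

lemma cyclic_superset: "v \<in> E \<Longrightarrow> v \<in> cyclic w E"
  by (auto simp: cyclic_def intro: exI[of _ 0])

text \<open>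
  Iterating \<open>w = w g\<close> gives \<open>w = w g\<^sup>j\<close>, and \<open>g\<close> is nilpotent.
\<close>

lemma not_self_act:
  assumes "w - w \<cdot> g \<in> K" shows "w \<in> K"
proof -
  have "w - w \<cdot> spow g j \<in> K" for j
  proof (induction j)
    case (Suc j)
    have "w - w \<cdot> spow g (Suc j) = (w - w \<cdot> g) + (w - w \<cdot> spow g j) \<cdot> g"
      by (simp add: act_diff_left act_act algebra_simps)
    then show ?case using K_add[OF assms K_act[OF Suc]] by metis
  qed (use assms in simp)
  moreover obtain j where "spow g j = 0" using nil by (auto simp: nil_ring_def nilpotent_def)
  ultimately show ?thesis by (metis act_zero_right diff_zero)
qed

text \<open>
  The kernel of \<open>X\<close> is invariant, so otherwise \<open>X\<close> is zero. Then \<open>V\<close> is simple over \<open>R\<close> itself,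
  which gives \<open>w = w g\<close> with \<open>w \<noteq> 0\<close>.
\<close>

lemma X_inj:
  assumes "X v \<in> K" shows "v \<in> K"
proof (rule ccontr)
  assume v: "v \<notin> K"
  have "submodule {v. X v \<in> K}"
    by (rule submoduleI) (auto simp: X_diff X_act K_diff K_act K_X)
  from submodule_UNIV[OF this _ _ v] have X0: "X u \<in> K" for u using assms K_X by auto
  obtain r where r: "v \<cdot> r \<notin> K" using act_faithful[OF v] by blast
  have "cyclic v K = UNIV"
    by (rule submodule_UNIV[OF submodule_cyclic[OF submodule_self] _ cyclic_act[OF submodule_self] r])
      (rule cyclic_superset[OF X0])
  then obtain g where "v - v \<cdot> g \<in> K" unfolding cyclic_def by blast
  then show False using not_self_act v by blast
qed

lemma Xn_inj: "(X ^^ i) v \<in> K \<Longrightarrow> v \<in> K"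
  by (induction i) (auto dest: X_inj)

lemma X_surj: "\<exists>v. X v - u \<in> K"
proof -
  let ?E = "{u. \<exists>v. X v - u \<in> K}"
  have "submodule ?E"
  proof (rule submoduleI)
    show "v \<in> ?E" if "v \<in> K" for v
      using that K_diff[OF K_zero that] Xn_zero[of 1] by (auto intro: exI[of _ 0])
    show "u - v \<in> ?E" if uv: "u \<in> ?E" "v \<in> ?E" for u v
    proof -
      obtain a b where "X a - u \<in> K" "X b - v \<in> K" using uv by blast
      then have "X (a - b) - (u - v) \<in> K" using K_diff by (fastforce simp: X_diff algebra_simps)
      then show ?thesis by blast
    qed
    show "v \<cdot> r \<in> ?E" if "v \<in> ?E" for v r
      using that K_act[of "X _ - v" r] by (auto simp: act_diff_left X_act[symmetric])
  qed
  moreover have "X v \<in> ?E" for v using K_zero by (auto intro: exI[of _ v])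
  moreover obtain v where "v \<notin> K" using nondegenerate by blast
  ultimately show ?thesis using submodule_UNIV[of ?E "X v"] X_inj by blast
qed

text \<open>
  The inverse of \<open>X\<close> on \<open>V\<close>. As a map on representatives it is an arbitrary choice, hence it is
  additive and \<open>R\<close>-linear only modulo \<open>K\<close>.
\<close>

definition Y :: "'v \<Rightarrow> 'v" where
  "Y u = (SOME v. X v - u \<in> K)"

lemma X_Y: "X (Y u) - u \<in> K"
  unfolding Y_def by (rule someI_ex[OF X_surj])

lemma Xn_Yn: "(X ^^ q) ((Y ^^ q) u) - u \<in> K"
proof (induction q arbitrary: u)
  case (Suc q)
  have "(X ^^ Suc q) ((Y ^^ Suc q) u) = X ((X ^^ q) ((Y ^^ q) (Y u)))"
    by (simp add: funpow_swap1)
  then have "(X ^^ Suc q) ((Y ^^ Suc q) u) - u = X ((X ^^ q) ((Y ^^ q) (Y u)) - Y u) + (X (Y u) - u)"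
    by (simp add: X_diff)
  then show ?case using K_add[OF K_X[OF Suc] X_Y] by metis
qed (simp add: K_zero)

lemma Yn_eqI:
  assumes "(X ^^ q) v - u \<in> K" shows "(Y ^^ q) u - v \<in> K"
proof (rule Xn_inj)
  show "(X ^^ q) ((Y ^^ q) u - v) \<in> K"
    using K_diff[OF Xn_Yn[of q u] assms] by (simp add: Xn_diff)
qed

lemma Yn_K: "u \<in> K \<Longrightarrow> (Y ^^ q) u \<in> K"
  using Yn_eqI[of q 0 u] K_diff[OF K_zero] by simp

lemma Yn_diff: "(Y ^^ q) (u - v) - ((Y ^^ q) u - (Y ^^ q) v) \<in> K"
  using K_diff[OF Xn_Yn[of q u] Xn_Yn[of q v]] by (intro Yn_eqI) (simp add: Xn_diff algebra_simps)

lemma Yn_cong: "u - v \<in> K \<Longrightarrow> (Y ^^ q) u - (Y ^^ q) v \<in> K"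
  using submodule_cong[OF submodule_self Yn_diff[of q u v]] Yn_K[of "u - v" q] by blast

lemma Yn_act: "(Y ^^ q) (v \<cdot> r) - (Y ^^ q) v \<cdot> r \<in> K"
  using K_act[OF Xn_Yn[of q v], of r] by (intro Yn_eqI) (simp add: Xn_act act_diff_left)

lemma Yn_Xn: "i \<le> q \<Longrightarrow> (Y ^^ q) ((X ^^ i) v) - (Y ^^ (q - i)) v \<in> K"
  using Xn_K[OF Xn_Yn[of "q - i" v], of i] by (intro Yn_eqI) (simp add: Xn_diff Xn_X)

lemma Xn_Yn_le: "i \<le> q \<Longrightarrow> (X ^^ i) ((Y ^^ q) v) - (Y ^^ (q - i)) v \<in> K"
proof (rule Xn_inj)
  assume "i \<le> q"
  then show "(X ^^ (q - i)) ((X ^^ i) ((Y ^^ q) v) - (Y ^^ (q - i)) v) \<in> K"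
    using K_diff[OF Xn_Yn[of q v] Xn_Yn[of "q - i" v]] by (simp add: Xn_diff Xn_X)
qed

lemma Yn_notin_K: "w \<notin> K \<Longrightarrow> (Y ^^ q) w \<notin> K"
  using Xn_K[of "(Y ^^ q) w" q] submodule_cong[OF submodule_self Xn_Yn[of q w]] by blast

text \<open>
  The elements \<open>b\<close> that are leading coefficients, in degree \<open>n\<close>, of a polynomial
  \<open>b x\<^sup>n + \<Sum>i<n. a\<^sub>i x\<^sup>i\<close> annihilating \<open>V\<close>.
\<close>

definition leading :: "nat \<Rightarrow> 'a set" where
  "leading n = {b. \<exists>a. \<forall>v. (X ^^ n) (v \<cdot> b) + (\<Sum>i<n. (X ^^ i) (v \<cdot> a i)) \<in> K}"

definition annihilator :: "'a set" where
  "annihilator = {r. \<forall>v. v \<cdot> r \<in> K}"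

end

section \<open>The degree-lowering ideal\<close>

text \<open>
  This locale is shown to be inconsistent. Its ideal \<open>B\<close> makes \<open>x\<close> behave like an algebraic
  element over \<open>R\<close>: on \<open>V\<close>, a factor from \<open>B\<close> lowers an exponent of \<open>x\<close> that is at least \<open>n\<close>.
\<close>

locale algebraic_module = polynomial_module act X K
  for act :: "'v::ab_group_add \<Rightarrow> 'a::ring \<Rightarrow> 'v" (infixl "\<cdot>" 75) and X K +
  fixes n :: nat
  assumes leading_not_annihilator: "\<not> leading n \<subseteq> annihilator"
begin

abbreviation B :: "'a set" where
  "B \<equiv> leading n"

lemma leading_mult_left:
  assumes "b \<in> B" shows "r * b \<in> B"
proof -
  obtain a where a: "\<And>v. (X ^^ n) (v \<cdot> b) + (\<Sum>i<n. (X ^^ i) (v \<cdot> a i)) \<in> K"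
    using assms unfolding leading_def by blast
  have "(X ^^ n) (v \<cdot> (r * b)) + (\<Sum>i<n. (X ^^ i) (v \<cdot> (r * a i))) \<in> K" for v
    using a[of "v \<cdot> r"] by (simp add: act_act)
  then show ?thesis unfolding leading_def by (intro CollectI exI[of _ "\<lambda>i. r * a i"] allI)
qed

lemma leading_faithful:
  assumes "w \<notin> K" shows "\<exists>b\<in>B. w \<cdot> b \<notin> K"
proof (rule ccontr)
  assume "\<not> ?thesis"
  then have w: "w \<in> {v. \<forall>b\<in>B. v \<cdot> b \<in> K}" by simp
  have "{v. \<forall>b\<in>B. v \<cdot> b \<in> K} = UNIV"
    by (rule submodule_UNIV[OF _ _ w assms])
      (auto intro!: submoduleI
        simp: act_diff_left act_act K_diff K_act X_act[symmetric] K_X leading_mult_left)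
  then show False using leading_not_annihilator by (auto simp: annihilator_def)
qed

text \<open>
  Products of \<open>k\<close> elements of \<open>B\<close> followed by an arbitrary element of \<open>R\<close>, standing for
  the power \<open>B\<^sup>k\<close>. Sums are left out because all targets of these products are submodules; the
  final factor makes \<open>BP 0\<close> and closure under right multiplication meaningful without an
  identity.
\<close>

primrec BP :: "nat \<Rightarrow> 'a set" where
  "BP 0 = UNIV"
| "BP (Suc k) = {b * c | b c. b \<in> B \<and> c \<in> BP k}"

lemma BP_mult_left: "c \<in> BP k \<Longrightarrow> r * c \<in> BP k"
  by (cases k) (auto, metis leading_mult_left mult.assoc)

lemma BP_mult_right: "c \<in> BP k \<Longrightarrow> c * r \<in> BP k"
  by (induction k arbitrary: c) (auto, metis mult.assoc)

lemma BP_antimono: "k \<le> l \<Longrightarrow> c \<in> BP l \<Longrightarrow> c \<in> BP k"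
proof (induction l rule: dec_induct)
  case (step l)
  then show ?case using BP_mult_left by auto
qed

lemma BP_faithful: "w \<notin> K \<Longrightarrow> \<exists>c\<in>BP k. w \<cdot> c \<notin> K"
proof (induction k arbitrary: w)
  case 0
  then show ?case using act_faithful by simp
next
  case (Suc k)
  obtain b where b: "b \<in> B" "w \<cdot> b \<notin> K" using leading_faithful[OF Suc.prems] by blast
  obtain c where c: "c \<in> BP k" "w \<cdot> b \<cdot> c \<notin> K" using Suc.IH[OF b(2)] by blast
  have "b * c \<in> BP (Suc k)" using b(1) c(1) by auto
  then show ?case using c(2) unfolding act_act by blast
qed

text \<open>
  The annihilator of a simple module is a prime ideal; this is the form with an explicit vector.
\<close>

lemma BP_prime:
  assumes z: "z \<notin> K" and r: "r \<notin> annihilator"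
  shows "\<exists>c\<in>BP k. z \<cdot> c \<cdot> r \<notin> K"
proof (rule ccontr)
  assume no: "\<not> ?thesis"
  obtain a where a: "a \<in> BP k" "z \<cdot> a \<notin> K" using BP_faithful[OF z] by blast
  let ?E = "{v. v \<cdot> r \<in> K \<and> (\<forall>s. v \<cdot> s \<cdot> r \<in> K)}"
  have zc: "z \<cdot> c \<cdot> r \<in> K" if "c \<in> BP k" for c using no that by blast
  have "?E = UNIV"
  proof (rule generated[OF a(2)])
    show "submodule ?E"
      by (rule submoduleI) (auto simp: act_diff_left K_diff K_act, simp add: act_act)
    have "z \<cdot> a \<cdot> s \<cdot> r \<in> K" for s
      using zc[OF BP_mult_right[OF a(1)]] by (simp add: act_act)
    then have "(X ^^ i) (z \<cdot> a \<cdot> s) \<cdot> r \<in> K" for i s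
      unfolding Xn_act[symmetric] by (rule Xn_K)
    moreover have "(X ^^ i) (z \<cdot> a \<cdot> s) \<cdot> t = (X ^^ i) (z \<cdot> a \<cdot> (s * t))" for i s t
      by (simp add: Xn_act[symmetric] act_act mult.assoc)
    ultimately show "(X ^^ i) (z \<cdot> a \<cdot> s) \<in> ?E" for i s
      by simp
  qed
  then show False using r by (auto simp: annihilator_def)
qed

section \<open>Dense submodules\<close>

text \<open>
  Density means that \<open>V / E\<close> is torsion for the powers of \<open>B\<close>. It plays the role of the equality
  \<open>E = V\<close> after extending scalars to the central closure of the prime ring that \<open>R\<close> induces on \<open>V\<close>.
\<close>

definition dense :: "'v set \<Rightarrow> bool" where
  "dense E \<longleftrightarrow> (\<forall>u. \<exists>k. \<forall>c\<in>BP k. u \<cdot> c \<in> E)"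

lemma submodule_torsion:
  assumes E: "submodule E"
  shows "submodule {u. \<forall>c\<in>BP k. u \<cdot> c \<in> E}"
  by (rule submoduleI)
    (auto simp: act_diff_left act_act BP_mult_left
      intro: submodule_K[OF E] submodule_diff[OF E] K_act)

lemma submodule_torsion_ex:
  assumes E: "submodule E"
  shows "submodule {u. \<exists>k. \<forall>c\<in>BP k. u \<cdot> c \<in> E}" (is "submodule ?T")
proof (rule submoduleI)
  show "v \<in> ?T" if "v \<in> K" for v
    using submodule_K[OF E K_act[OF that]] by blast
  show "u - v \<in> ?T" if uv: "u \<in> ?T" "v \<in> ?T" for u v
  proof -
    obtain k l where "\<forall>c\<in>BP k. u \<cdot> c \<in> E" "\<forall>c\<in>BP l. v \<cdot> c \<in> E" using uv by blast
    then have "\<forall>c\<in>BP (max k l). (u - v) \<cdot> c \<in> E"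
      using BP_antimono[of k "max k l"] BP_antimono[of l "max k l"]
      by (auto simp: act_diff_left intro: submodule_diff[OF E])
    then show ?thesis by blast
  qed
  show "v \<cdot> r \<in> ?T" if "v \<in> ?T" for v r
    using that by (auto simp: act_act intro: BP_mult_left)
qed

text \<open>
  Over that central closure \<open>x\<close> is algebraic of degree at most \<open>n\<close>, so \<open>w, w x, \<dots>, w x\<^sup>n\<^sup>-\<^sup>1\<close> generate \<open>V\<close>. With
  \<open>k\<close> factors from \<open>B\<close>, exponents of \<open>x\<close> below \<open>n + k\<close> can be brought below \<open>n\<close>, one factor
  at a time.
\<close>

lemma dense_if_generators:
  assumes w: "w \<notin> K" and E: "submodule E" and gen: "\<And>i r. i < n \<Longrightarrow> (X ^^ i) (w \<cdot> r) \<in> E"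
  shows "dense E"
proof -
  have step: "(X ^^ j) (w \<cdot> r \<cdot> c) \<in> E" if "c \<in> BP k" "j < n + k" for k j r c
    using that
  proof (induction k arbitrary: j r c)
    case 0
    then show ?case using gen by (simp add: act_act)
  next
    case (Suc k)
    then obtain b d where c: "c = b * d" "b \<in> B" "d \<in> BP k" by auto
    show ?case
    proof (cases "j < n")
      case True
      then show ?thesis using gen by (simp add: act_act)
    next
      case False
      then obtain l where j: "j = l + n" by (metis add.commute le_Suc_ex not_less)
      obtain a where a: "\<And>v. (X ^^ n) (v \<cdot> (r * b)) + (\<Sum>i<n. (X ^^ i) (v \<cdot> a i)) \<in> K"
        using leading_mult_left[OF c(2)] unfolding leading_def by blast
      define S where "S = (X ^^ n) (w \<cdot> (r * b))"
      define T where "T = (\<Sum>i<n. (X ^^ i) (w \<cdot> a i))"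
      have "(X ^^ l) (T \<cdot> d) = (\<Sum>i<n. (X ^^ (l + i)) (w \<cdot> a i \<cdot> d))"
        by (simp add: T_def act_sum Xn_sum Xn_act[symmetric] Xn_X)
      moreover have "(X ^^ (l + i)) (w \<cdot> a i \<cdot> d) \<in> E" if "i < n" for i
        using Suc.IH[OF c(3)] Suc.prems(2) j that by simp
      ultimately have "(X ^^ l) (T \<cdot> d) \<in> E"
        using submodule_sum[OF E, of "{..<n}" "\<lambda>i. (X ^^ (l + i)) (w \<cdot> a i \<cdot> d)"] by simp
      moreover have "(X ^^ l) ((S + T) \<cdot> d) \<in> E"
        using a[of w] by (intro submodule_K[OF E] Xn_K K_act) (simp add: S_def T_def)
      ultimately have "(X ^^ l) (S \<cdot> d) \<in> E"
        using submodule_diff[OF E] by (force simp: act_add_left Xn_add)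
      then show ?thesis by (simp add: j c(1) S_def act_act mult.assoc Xn_act[symmetric] Xn_X)
    qed
  qed
  have "{u. \<exists>k. \<forall>c\<in>BP k. u \<cdot> c \<in> E} = UNIV"
  proof (rule generated[OF w submodule_torsion_ex[OF E]])
    fix j r
    have "\<forall>c\<in>BP (Suc j). (X ^^ j) (w \<cdot> r) \<cdot> c \<in> E"
      using step[where k = "Suc j"] by (simp only: Xn_act[symmetric]) simp
    then show "(X ^^ j) (w \<cdot> r) \<in> {u. \<exists>k. \<forall>c\<in>BP k. u \<cdot> c \<in> E}" by blast
  qed
  then show ?thesis unfolding dense_def by blast
qed

text \<open>
  If \<open>u = \<Sum>i\<le>p. w s\<^sub>i x\<^sup>i\<close> and \<open>q \<ge> p\<close>, then \<open>Y\<^sup>q u = \<Sum>i\<le>p. (Y\<^sup>q\<^sup>-\<^sup>i w) s\<^sub>i\<close>. Quantifying over the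
  submodules \<open>N\<close> expresses membership in the submodule generated by the \<open>Y\<^sup>j w\<close>.
\<close>

lemma Yn_eventually:
  assumes w: "w \<notin> K"
  shows "\<exists>p. \<forall>q\<ge>p. \<forall>N. submodule N \<longrightarrow> (\<forall>j\<le>q. (Y ^^ j) w \<in> N) \<longrightarrow> (Y ^^ q) u \<in> N"
proof -
  let ?P = "\<lambda>u p. \<forall>q\<ge>p. \<forall>N. submodule N \<longrightarrow> (\<forall>j\<le>q. (Y ^^ j) w \<in> N) \<longrightarrow> (Y ^^ q) u \<in> N"
  have "{u. \<exists>p. ?P u p} = UNIV"
  proof (rule generated[OF w], rule submoduleI)
    show "v \<in> {u. \<exists>p. ?P u p}" if "v \<in> K" for v
      using Yn_K[OF that] by (auto intro: submodule_K)
    show "u - v \<in> {u. \<exists>p. ?P u p}" if uv: "u \<in> {u. \<exists>p. ?P u p}" "v \<in> {u. \<exists>p. ?P u p}" for u v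
    proof -
      obtain p p' where p: "?P u p" "?P v p'" using uv by blast
      have "?P (u - v) (max p p')"
      proof (intro allI impI)
        fix q N assume "max p p' \<le> q" and N: "submodule N" and "\<forall>j\<le>q. (Y ^^ j) w \<in> N"
        then have "(Y ^^ q) u \<in> N" "(Y ^^ q) v \<in> N" using p by auto
        then show "(Y ^^ q) (u - v) \<in> N"
          using submodule_cong[OF N Yn_diff] submodule_diff[OF N] by blast
      qed
      then show ?thesis by blast
    qed
    show "v \<cdot> r \<in> {u. \<exists>p. ?P u p}" if v: "v \<in> {u. \<exists>p. ?P u p}" for v r
    proof -
      obtain p where p: "?P v p" using v by blast
      have "?P (v \<cdot> r) p"
      proof (intro allI impI)
        fix q N assume "p \<le> q" and N: "submodule N" and "\<forall>j\<le>q. (Y ^^ j) w \<in> N"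
        then have "(Y ^^ q) v \<in> N" using p by blast
        then show "(Y ^^ q) (v \<cdot> r) \<in> N"
          using submodule_cong[OF N Yn_act] submodule_act[OF N] by blast
      qed
      then show ?thesis by blast
    qed
    show "(X ^^ i) (w \<cdot> r) \<in> {u. \<exists>p. ?P u p}" for i r
    proof -
      have "?P ((X ^^ i) w \<cdot> r) i"
      proof (intro allI impI)
        fix q N assume "i \<le> q" and N: "submodule N" and "\<forall>j\<le>q. (Y ^^ j) w \<in> N"
        then have "(Y ^^ q) ((X ^^ i) w) \<in> N"
          using submodule_cong[OF N Yn_Xn[of i q w]] by auto
        then show "(Y ^^ q) ((X ^^ i) w \<cdot> r) \<in> N"
          using submodule_cong[OF N Yn_act] submodule_act[OF N] by blast
      qed
      then show ?thesis unfolding Xn_act by blast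
    qed
  qed
  then show ?thesis by blast
qed

text \<open>
  The vector \<open>Y w\<close> lies in \<open>w R[x]\<close>, so the preceding lemma expresses \<open>Y\<^sup>q\<^sup>+\<^sup>1 w\<close> by the \<open>Y\<^sup>j w\<close> with
  \<open>j \<le> q\<close> for all large \<open>q\<close>: the inverse of \<open>x\<close> is integral over \<open>R\<close> at \<open>w\<close>.
\<close>

lemma Yn_integral:
  assumes w: "w \<notin> K"
  shows "\<exists>p. \<forall>N. submodule N \<longrightarrow> (\<forall>j\<le>p. (Y ^^ j) w \<in> N) \<longrightarrow> (\<forall>q. (Y ^^ q) w \<in> N)"
proof -
  obtain p where p: "\<And>q N. q \<ge> p \<Longrightarrow> submodule N \<Longrightarrow> (\<And>j. j \<le> q \<Longrightarrow> (Y ^^ j) w \<in> N) \<Longrightarrow>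
      (Y ^^ q) (Y w) \<in> N"
    using Yn_eventually[OF w, of "Y w"] by blast
  have "(Y ^^ q) w \<in> N" if N: "submodule N" "\<forall>j\<le>p. (Y ^^ j) w \<in> N" for N q
  proof (induction q rule: less_induct)
    case (less q)
    show ?case
    proof (cases "q \<le> p")
      case False
      then obtain q' where q': "q = Suc q'" "p \<le> q'" by (cases q) auto
      then have "(Y ^^ q') (Y w) \<in> N" using less by (intro p[OF _ N(1)]) auto
      then show ?thesis by (simp add: q'(1) funpow_swap1)
    qed (use N in simp)
  qed
  then show ?thesis by blast
qed

text \<open>
  By integrality a single exponent \<open>l\<close> suffices to move all \<open>(Y\<^sup>q w) c\<close> with \<open>c \<in> BP l\<close> into \<open>E\<close>.
  Only after \<open>l\<close> is known, \<open>w\<close> is written as \<open>\<Sum>i. w a s\<^sub>i x\<^sup>i\<close> with \<open>a \<in> BP l\<close>, so that \<open>a\<close> absorbs the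
  torsion and \<open>Y\<^sup>q w = \<Sum>i. (Y\<^sup>q\<^sup>-\<^sup>i w) a s\<^sub>i\<close> lies in \<open>E\<close> for large \<open>q\<close>.
\<close>

lemma dense_Yn:
  assumes w: "w \<notin> K" and E: "submodule E" and dense: "dense E"
  shows "\<exists>p. \<forall>q\<ge>p. (Y ^^ q) w \<in> E"
proof -
  obtain p where p: "\<And>N. submodule N \<Longrightarrow> \<forall>j\<le>p. (Y ^^ j) w \<in> N \<Longrightarrow> \<forall>q. (Y ^^ q) w \<in> N"
    using Yn_integral[OF w] by blast
  have "\<forall>j. \<exists>k. \<forall>c\<in>BP k. (Y ^^ j) w \<cdot> c \<in> E" using dense unfolding dense_def by blast
  then obtain k where k: "\<And>j c. c \<in> BP (k j) \<Longrightarrow> (Y ^^ j) w \<cdot> c \<in> E" by metis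
  define l where "l = Max (k ` {..p})"
  have "k j \<le> l" if "j \<le> p" for j using that by (simp add: l_def)
  then have "\<forall>j\<le>p. (Y ^^ j) w \<in> {u. \<forall>c\<in>BP l. u \<cdot> c \<in> E}"
    using k BP_antimono by blast
  from p[OF submodule_torsion[OF E] this]
  have Yw: "(Y ^^ q) w \<cdot> c \<in> E" if "c \<in> BP l" for q c using that by blast
  obtain a where a: "a \<in> BP l" "w \<cdot> a \<notin> K" using BP_faithful[OF w] by blast
  obtain p' where p': "\<And>q. q \<ge> p' \<Longrightarrow> (\<And>j. j \<le> q \<Longrightarrow> (Y ^^ j) (w \<cdot> a) \<in> E) \<Longrightarrow> (Y ^^ q) w \<in> E"
    using Yn_eventually[OF a(2), of w] E by blast
  have "(Y ^^ j) (w \<cdot> a) \<in> E" for j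
    using Yw[OF a(1)] submodule_cong[OF E Yn_act] by blast
  then show ?thesis using p' by blast
qed

text \<open>
  The powers \<open>X\<^sup>i\<close> with \<open>i < n\<close> take \<open>Y\<^sup>p\<^sup>+\<^sup>n w\<close> to the \<open>Y\<^sup>q w\<close> in the given range, so
  \<open>dense_if_generators\<close> applies to a nonzero \<open>(Y\<^sup>p\<^sup>+\<^sup>n w) a\<close> with \<open>a \<in> BP k\<close>. Together with the preceding
  lemma this reduces density to finitely many membership conditions, so that a chain with a dense
  union has a dense member.
\<close>

lemma dense_if_Yn:
  assumes w: "w \<notin> K" and E: "submodule E"
    and mem: "\<And>q c. p \<le> q \<Longrightarrow> q \<le> p + n \<Longrightarrow> c \<in> BP k \<Longrightarrow> (Y ^^ q) w \<cdot> c \<in> E"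
  shows "dense E"
proof -
  obtain a where a: "a \<in> BP k" "(Y ^^ (p + n)) w \<cdot> a \<notin> K"
    using BP_faithful[OF Yn_notin_K[OF w]] by blast
  show ?thesis
  proof (rule dense_if_generators[OF a(2) E])
    fix i r assume i: "i < n"
    have "(X ^^ i) ((Y ^^ (p + n)) w) \<cdot> (a * r) - (Y ^^ (p + n - i)) w \<cdot> (a * r) \<in> K"
      using K_act[OF Xn_Yn_le[of i "p + n" w]] i by (simp add: act_diff_left)
    moreover have "(Y ^^ (p + n - i)) w \<cdot> (a * r) \<in> E"
      using i by (intro mem BP_mult_right a) auto
    ultimately show "(X ^^ i) ((Y ^^ (p + n)) w \<cdot> a \<cdot> r) \<in> E"
      using submodule_cong[OF E] by (auto simp: act_act Xn_act)
  qed
qed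

lemma dense_superset: "dense E \<Longrightarrow> E \<subseteq> F \<Longrightarrow> dense F"
  unfolding dense_def by blast

lemma not_dense_K: "\<not> dense K"
proof
  assume "dense K"
  obtain u where "u \<notin> K" using nondegenerate by blast
  then show False using \<open>dense K\<close> BP_faithful[of u] unfolding dense_def by blast
qed

text \<open>
  Density of \<open>w R\<close> gives \<open>Y\<^sup>p w = w g\<close> for some \<open>p\<close> and some \<open>g \<in> R\<close>. As \<open>Y\<close> commutes with \<open>R\<close>, iteration
  yields \<open>Y\<^sup>p\<^sup>j w = w g\<^sup>j = 0\<close> for large \<open>j\<close>, although \<open>Y\<close> is injective.
\<close>

lemma not_dense_cyclic:
  assumes w: "w \<notin> K"
  shows "\<not> dense (cyclic w K)"
proof
  assume "dense (cyclic w K)"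
  then obtain p where "(Y ^^ p) w \<in> cyclic w K"
    using dense_Yn[OF w submodule_cyclic[OF submodule_self]] by blast
  then obtain g where g: "(Y ^^ p) w - w \<cdot> g \<in> K" by (auto simp: cyclic_def)
  have "(Y ^^ (p * Suc j)) w - w \<cdot> spow g j \<in> K" for j
  proof (induction j)
    case (Suc j)
    have "(Y ^^ (p * Suc (Suc j))) w = (Y ^^ p) ((Y ^^ (p * Suc j)) w)"
      by (simp add: funpow_add)
    then have "(Y ^^ (p * Suc (Suc j))) w - w \<cdot> spow g (Suc j) =
        ((Y ^^ p) ((Y ^^ (p * Suc j)) w) - (Y ^^ p) (w \<cdot> spow g j)) +
        (((Y ^^ p) (w \<cdot> spow g j) - (Y ^^ p) w \<cdot> spow g j) +
         ((Y ^^ p) w - w \<cdot> g) \<cdot> spow g j)"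
      by (simp add: act_diff_left act_act spow_commute del: mult_Suc_right)
    then show ?case
      using K_add[OF Yn_cong[OF Suc] K_add[OF Yn_act K_act[OF g]]] by metis
  qed (use g in simp)
  moreover obtain j where "spow g j = 0" using nil by (auto simp: nil_ring_def nilpotent_def)
  ultimately have "(Y ^^ (p * Suc j)) w \<in> K" by (metis act_zero_right diff_zero)
  then show False using Yn_notin_K[OF w] by blast
qed

section \<open>Maximal non-dense submodules\<close>

text \<open>
  Up to torsion, \<open>V / E\<close> is then a simple module over \<open>R\<close>.
\<close>

definition maximal_nondense :: "'v set \<Rightarrow> bool" where
  "maximal_nondense E \<longleftrightarrow>
     submodule E \<and> \<not> dense E \<and> (\<forall>F. submodule F \<longrightarrow> E \<subset> F \<longrightarrow> dense F)"

lemma maximal_nondense_exists: "\<exists>E. maximal_nondense E"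
proof -
  obtain w where w: "w \<notin> K" using nondegenerate by blast
  define \<F> where "\<F> = {E. submodule E \<and> \<not> dense E}"
  have "\<exists>M\<in>\<F>. \<forall>E\<in>\<F>. M \<subseteq> E \<longrightarrow> E = M"
  proof (rule subset_Zorn_nonempty)
    show "\<F> \<noteq> {}" using submodule_self not_dense_K by (auto simp: \<F>_def)
    fix C assume C: "C \<noteq> {}" "subset.chain \<F> C"
    have sub: "submodule F" and nd: "\<not> dense F" if "F \<in> C" for F
      using C(2) that by (auto simp: subset.chain_def \<F>_def)
    have lin: "F \<subseteq> G \<or> G \<subseteq> F" if "F \<in> C" "G \<in> C" for F G
      using C(2) that by (auto simp: subset.chain_def)
    have directed: "\<exists>F\<in>C. S \<subseteq> F" if "finite S" "S \<subseteq> \<Union>C" for S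
      using that
    proof (induction S rule: finite_induct)
      case (insert x S)
      then obtain F G where "F \<in> C" "S \<subseteq> F" "G \<in> C" "x \<in> G" by auto
      then show ?case using lin[of F G] by blast
    qed (use C(1) in auto)
    have union: "submodule (\<Union>C)"
    proof (rule submoduleI)
      show "v \<in> \<Union>C" if "v \<in> K" for v using C(1) sub submodule_K that by blast
      show "u - v \<in> \<Union>C" if uv: "u \<in> \<Union>C" "v \<in> \<Union>C" for u v
      proof -
        obtain F where "F \<in> C" "u \<in> F" "v \<in> F" using directed[of "{u, v}"] uv by auto
        then show ?thesis using sub submodule_diff by blast
      qed
      show "v \<cdot> r \<in> \<Union>C" if "v \<in> \<Union>C" for v r
        using that sub submodule_act by blast
    qed
    moreover have "\<not> dense (\<Union>C)"
    proof
      assume "dense (\<Union>C)"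
      then obtain p where p: "\<And>q. q \<ge> p \<Longrightarrow> (Y ^^ q) w \<in> \<Union>C"
        using dense_Yn[OF w union] by blast
      obtain F where F: "F \<in> C" "(\<lambda>q. (Y ^^ q) w) ` {p..p + n} \<subseteq> F"
        using directed[of "(\<lambda>q. (Y ^^ q) w) ` {p..p + n}"] p by fastforce
      have "dense F"
      proof (rule dense_if_Yn[OF w sub[OF F(1)], of p 0])
        fix q c assume "p \<le> q" "q \<le> p + n"
        then have "(Y ^^ q) w \<in> F" using F(2) by (simp add: image_subset_iff)
        then show "(Y ^^ q) w \<cdot> c \<in> F" by (rule submodule_act[OF sub[OF F(1)]])
      qed
      then show False using nd F(1) by blast
    qed
    ultimately show "\<Union>C \<in> \<F>" by (simp add: \<F>_def)
  qed
  then show ?thesis unfolding \<F>_def maximal_nondense_def by blast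
qed

section \<open>The annihilator and simplicity modulo a maximal non-dense submodule\<close>

lemma annihilator_mult_left: "r \<in> annihilator \<Longrightarrow> s * r \<in> annihilator"
  by (simp add: annihilator_def act_act[symmetric])

lemma annihilator_mult_right: "r \<in> annihilator \<Longrightarrow> r * s \<in> annihilator"
  by (simp add: annihilator_def act_act[symmetric] K_act)

lemma annihilator_add: "r \<in> annihilator \<Longrightarrow> s \<in> annihilator \<Longrightarrow> r + s \<in> annihilator"
  by (simp add: annihilator_def act_add_right K_add)

lemma zero_annihilator: "0 \<in> annihilator"
  by (simp add: annihilator_def K_zero)

lemma annihilator_cancel_BP:
  assumes "\<And>c. c \<in> BP k \<Longrightarrow> r * c \<in> annihilator" shows "r \<in> annihilator"
proof (rule ccontr)
  assume "r \<notin> annihilator"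
  then obtain v where "v \<cdot> r \<notin> K" by (auto simp: annihilator_def)
  then obtain c where "c \<in> BP k" "v \<cdot> r \<cdot> c \<notin> K" using BP_faithful by blast
  then show False using assms by (auto simp: annihilator_def act_act)
qed

lemma annihilator_prime:
  assumes "\<And>s. r * s * t \<in> annihilator" shows "r \<in> annihilator \<or> t \<in> annihilator"
proof (rule ccontr)
  assume no: "\<not> ?thesis"
  then obtain v where "v \<cdot> r \<notin> K" by (auto simp: annihilator_def)
  then obtain s where "v \<cdot> r \<cdot> s \<cdot> t \<notin> K" using BP_prime no by blast
  then show False using assms by (auto simp: annihilator_def act_act)
qed

lemma
  assumes "maximal_nondense E"
  shows maximal_nondense_submodule: "submodule E"
    and maximal_nondense_not_dense: "\<not> dense E"
    and maximal_nondense_dense: "submodule F \<Longrightarrow> E \<subseteq> F \<Longrightarrow> v \<in> F \<Longrightarrow> v \<notin> E \<Longrightarrow> dense F"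
  using assms unfolding maximal_nondense_def by auto

text \<open>
  The vectors that \<open>R\<close> takes into \<open>E\<close> form a submodule containing \<open>E\<close>; were it larger, it would be
  dense, and then \<open>E\<close> would contain all \<open>(Y\<^sup>q w) c\<close> for large \<open>q\<close> and be dense as well.
\<close>

lemma maximal_nondense_act:
  assumes E: "maximal_nondense E" and v: "v \<notin> E"
  shows "\<exists>r. v \<cdot> r \<notin> E"
proof (rule ccontr)
  note sE = maximal_nondense_submodule[OF E]
  assume "\<not> ?thesis"
  then have vF: "v \<in> {v. \<forall>c\<in>BP 0. v \<cdot> c \<in> E}" by simp
  have F: "submodule {v. \<forall>c\<in>BP 0. v \<cdot> c \<in> E}" by (rule submodule_torsion[OF sE])
  have dF: "dense {v. \<forall>c\<in>BP 0. v \<cdot> c \<in> E}"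
    by (rule maximal_nondense_dense[OF E F _ vF v]) (auto intro: submodule_act[OF sE])
  obtain w where w: "w \<notin> K" using nondegenerate by blast
  obtain p where "\<forall>q\<ge>p. (Y ^^ q) w \<in> {v. \<forall>c\<in>BP 0. v \<cdot> c \<in> E}"
    using dense_Yn[OF w F dF] by blast
  then have "dense E" by (intro dense_if_Yn[OF w sE, of p 0]) blast
  then show False using maximal_nondense_not_dense[OF E] by blast
qed

lemma dense_cyclic:
  assumes E: "maximal_nondense E" and v: "v \<notin> E"
  shows "dense (cyclic v E)"
proof -
  note sE = maximal_nondense_submodule[OF E]
  obtain r where r: "v \<cdot> r \<notin> E" using maximal_nondense_act[OF E v] by blast
  show ?thesis
    by (rule maximal_nondense_dense[OF E submodule_cyclic[OF sE] _ cyclic_act[OF sE] r])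
      (auto intro: cyclic_superset)
qed

text \<open>
  The quotient \<open>V / E\<close> is too large for finitely many of its vectors to have annihilator zero, where
  zero in \<open>R\<close> means annihilating \<open>V\<close>. Let \<open>L\<close> be the right ideal taking the first \<open>k\<close> vectors into
  \<open>E\<close>, and suppose that no nonzero element of \<open>L\<close> takes \<open>u\<^sub>k\<close> into \<open>E\<close>. Then \<open>L\<close> embeds into \<open>V / E\<close>,
  and by simplicity of the latter \<open>a\<^sub>0 R\<close> contains, up to torsion, all of \<open>L\<close> for every nonzero
  \<open>a\<^sub>0 \<in> L\<close>. Nilness allows taking for \<open>a\<^sub>0\<close> the last nonzero power of a given \<open>a \<in> L\<close>; then
  \<open>a a\<^sub>0 = 0\<close>, hence \<open>a L = 0\<close>. So \<open>L L = 0\<close>, against primeness.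
\<close>

lemma finite_annihilator:
  fixes k :: nat and u :: "nat \<Rightarrow> 'v"
  assumes E: "maximal_nondense E"
  shows "\<exists>r. r \<notin> annihilator \<and> (\<forall>i<k. u i \<cdot> r \<in> E)"
proof (induction k)
  case 0
  then show ?case using nondegenerate by (auto simp: annihilator_def)
next
  case (Suc k)
  note sE = maximal_nondense_submodule[OF E]
  define L where "L = {r. \<forall>i<k. u i \<cdot> r \<in> E}"
  have L_right: "l * s \<in> L" if "l \<in> L" for l s
    using that submodule_act[OF sE] by (auto simp: L_def act_act[symmetric])
  have L_diff: "l - l' \<in> L" if "l \<in> L" "l' \<in> L" for l l'
    using that submodule_diff[OF sE] by (auto simp: L_def act_diff_right)
  obtain l where l: "l \<in> L" "l \<notin> annihilator" using Suc by (auto simp: L_def)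
  show ?case
  proof (rule ccontr)
    assume no: "\<not> ?case"
    have ann: "r \<in> annihilator" if "r \<in> L" "u k \<cdot> r \<in> E" for r
      using no that by (auto simp: L_def less_Suc_eq)
    have LL: "a * b \<in> annihilator" if a: "a \<in> L" and b: "b \<in> L" for a b
    proof (cases "a \<in> annihilator")
      case True
      then show ?thesis by (rule annihilator_mult_right)
    next
      case False
      obtain N where "spow a N = 0" using nil by (auto simp: nil_ring_def nilpotent_def)
      then have "\<exists>N. spow a N \<in> annihilator" using zero_annihilator by metis
      then obtain h where h: "spow a h \<in> annihilator" "\<And>j. j < h \<Longrightarrow> spow a j \<notin> annihilator"
        using exists_least_iff[of "\<lambda>N. spow a N \<in> annihilator"] by auto
      from h(1) False obtain g where g: "h = Suc g" by (cases h) auto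
      define a0 where "a0 = spow a g"
      have aa0: "a * a0 \<in> annihilator" using h(1) by (simp add: g a0_def spow_commute)
      have a0: "a0 \<notin> annihilator" using h(2) by (simp add: g a0_def)
      have a0L: "a0 \<in> L"
        unfolding a0_def using a L_right[OF a] by (cases g) (auto simp: spow_commute[symmetric])
      have "u k \<cdot> a0 \<notin> E" using ann[OF a0L] a0 by blast
      from dense_cyclic[OF E this] obtain j
        where j: "\<And>c. c \<in> BP j \<Longrightarrow> u k \<cdot> c \<in> cyclic (u k \<cdot> a0) E"
        unfolding dense_def by blast
      have "a * c \<in> annihilator" if c: "c \<in> L" "c \<in> BP j" for c
      proof -
        obtain r where "u k \<cdot> c - u k \<cdot> a0 \<cdot> r \<in> E" using j[OF c(2)] by (auto simp: cyclic_def)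
        then have "u k \<cdot> (c - a0 * r) \<in> E" by (simp add: act_diff_right act_act)
        then have "c - a0 * r \<in> annihilator" by (intro ann L_diff c L_right a0L)
        from annihilator_add[OF annihilator_mult_left[OF this, of a]
            annihilator_mult_right[OF aa0, of r]]
        show ?thesis by (simp add: algebra_simps)
      qed
      then have "a * b * c \<in> annihilator" if "c \<in> BP j" for c
        using L_right[OF b] BP_mult_left[OF that] by (simp add: mult.assoc)
      then show ?thesis by (rule annihilator_cancel_BP)
    qed
    have "l * s * l \<in> annihilator" for s by (intro LL L_right l)
    then show False using annihilator_prime l(2) by blast
  qed
qed

section \<open>A dense cyclic submodule\<close>

text \<open>
  A decreasing chain of submodules from \<open>V\<close> at \<open>j = 0\<close> to zero at \<open>j = n\<close>; each step intersects with
  a translate of the maximal non-dense submodule \<open>E\<close> under a power of \<open>Y\<close>.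
\<close>

definition shift_core :: "'v set \<Rightarrow> nat \<Rightarrow> 'v set" where
  "shift_core E j = {v. \<forall>i<j. (X ^^ i) v \<in> E}"

lemma submodule_shift_core: "submodule E \<Longrightarrow> submodule (shift_core E j)"
  unfolding shift_core_def
  by (rule submoduleI) (auto simp: Xn_diff Xn_act submodule_K submodule_diff submodule_act Xn_K)

lemma shift_core_n:
  assumes E: "maximal_nondense E"
  shows "shift_core E n = K"
proof -
  note sE = maximal_nondense_submodule[OF E]
  have "v \<in> K" if v: "v \<in> shift_core E n" for v
  proof (rule ccontr)
    assume "v \<notin> K"
    then have "dense E"
      by (rule dense_if_generators[OF _ sE])
        (use v in \<open>auto simp: shift_core_def Xn_act intro: submodule_act[OF sE]\<close>)
    then show False using maximal_nondense_not_dense[OF E] by blast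
  qed
  then show ?thesis using submodule_K[OF submodule_shift_core[OF sE]] by blast
qed

text \<open>
  Write \<open>C\<^sub>j\<close> for \<open>shift_core E j\<close>. If \<open>X\<^sup>j\<close> does not map \<open>C\<^sub>j\<close> into \<open>E\<close>, then \<open>X\<^sup>j C\<^sub>j + E\<close> is dense by maximality. Were
  \<open>X\<^sup>j (C\<^sub>j J)\<close> contained in \<open>E\<close>, then \<open>J\<close> would map all of \<open>X\<^sup>j C\<^sub>j + E\<close> into \<open>E\<close>. For suitable \<open>c\<close> this
  applies to the \<open>(X\<^sup>i w) c\<close> with \<open>i < n\<close>, and by primeness \<open>c\<close> can be chosen with \<open>w c r\<close> nonzero.
  Then \<open>E\<close> contains generators of a dense submodule.
\<close>

lemma separating_vector:
  assumes E: "maximal_nondense E" and v: "v \<in> shift_core E j" "(X ^^ j) v \<notin> E"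
    and J_right: "\<And>r s. r \<in> J \<Longrightarrow> r * s \<in> J" and r: "r \<in> J" "r \<notin> annihilator"
  shows "\<exists>t\<in>shift_core E j. \<exists>s\<in>J. (X ^^ j) (t \<cdot> s) \<notin> E"
proof (rule ccontr)
  note sE = maximal_nondense_submodule[OF E]
  note sC = submodule_shift_core[OF sE, of j]
  assume "\<not> ?thesis"
  then have no: "(X ^^ j) (t \<cdot> s) \<in> E" if "t \<in> shift_core E j" "s \<in> J" for t s
    using that by blast
  let ?F = "{u. \<exists>t\<in>shift_core E j. u - (X ^^ j) t \<in> E}"
  have F: "submodule ?F"
  proof (rule submoduleI)
    show "u \<in> ?F" if "u \<in> K" for u
      using submodule_K[OF sE that] submodule_zero[OF sC] by (auto intro!: bexI[of _ 0])
    show "u - u' \<in> ?F" if u: "u \<in> ?F" "u' \<in> ?F" for u u'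
    proof -
      obtain t t' where t: "t \<in> shift_core E j" "u - (X ^^ j) t \<in> E"
        "t' \<in> shift_core E j" "u' - (X ^^ j) t' \<in> E" using u by blast
      have "(u - u') - (X ^^ j) (t - t') = (u - (X ^^ j) t) - (u' - (X ^^ j) t')"
        by (simp add: Xn_diff)
      then have "(u - u') - (X ^^ j) (t - t') \<in> E" using submodule_diff[OF sE t(2,4)] by metis
      then show ?thesis using submodule_diff[OF sC t(1,3)] by blast
    qed
    show "u \<cdot> s \<in> ?F" if u: "u \<in> ?F" for u s
    proof -
      obtain t where t: "t \<in> shift_core E j" "u - (X ^^ j) t \<in> E" using u by blast
      have "u \<cdot> s - (X ^^ j) (t \<cdot> s) = (u - (X ^^ j) t) \<cdot> s" by (simp add: act_diff_left Xn_act)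
      then have "u \<cdot> s - (X ^^ j) (t \<cdot> s) \<in> E" using submodule_act[OF sE t(2)] by metis
      then show ?thesis using submodule_act[OF sC t(1)] by blast
    qed
  qed
  have "E \<subseteq> ?F" using submodule_zero[OF sC] by (auto intro!: bexI[of _ 0])
  moreover have "(X ^^ j) v \<in> ?F" using v(1) submodule_zero[OF sE] by (auto intro!: bexI[of _ v])
  ultimately have dF: "dense ?F" using maximal_nondense_dense[OF E F] v(2) by blast
  obtain w where w: "w \<notin> K" using nondegenerate by blast
  have "\<forall>i. \<exists>k. \<forall>c\<in>BP k. (X ^^ i) w \<cdot> c \<in> ?F" using dF unfolding dense_def by blast
  from choice[OF this] obtain k where k: "\<And>i c. c \<in> BP (k i) \<Longrightarrow> (X ^^ i) w \<cdot> c \<in> ?F"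
    by blast
  define l where "l = Max (k ` {..n})"
  have kl: "k i \<le> l" if "i \<le> n" for i using that by (simp add: l_def)
  obtain c where c: "c \<in> BP l" "w \<cdot> c \<cdot> r \<notin> K" using BP_prime[OF w r(2)] by blast
  have "dense E"
  proof (rule dense_if_generators[OF c(2) sE])
    fix i s assume i: "i < n"
    have "(X ^^ i) w \<cdot> c \<in> ?F" using i by (intro k BP_antimono[OF kl c(1)]) auto
    then obtain t where t: "t \<in> shift_core E j" "(X ^^ i) w \<cdot> c - (X ^^ j) t \<in> E" by blast
    have "(X ^^ i) (w \<cdot> c \<cdot> r \<cdot> s) =
        ((X ^^ i) w \<cdot> c - (X ^^ j) t) \<cdot> (r * s) + (X ^^ j) (t \<cdot> (r * s))"
      by (simp add: act_diff_left Xn_act act_act mult.assoc)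
    then show "(X ^^ i) (w \<cdot> c \<cdot> r \<cdot> s) \<in> E"
      using submodule_add[OF sE submodule_act[OF sE t(2)] no[OF t(1) J_right[OF r(1)]]] by metis
  qed
  then show False using maximal_nondense_not_dense[OF E] by blast
qed

text \<open>
  The vector \<open>w\<^sub>1\<close> is corrected by some \<open>t\<close> in \<open>C\<^sub>j\<close>, the set \<open>shift_core E j\<close>, which does not change \<open>w\<^sub>1 R\<close> modulo
  \<open>C\<^sub>j\<close>, so that \<open>w\<^sub>2 R\<close> contains a vector \<open>v\<^sub>2\<close> of \<open>C\<^sub>j\<close> with \<open>X\<^sup>j v\<^sub>2\<close> outside \<open>E\<close>. By simplicity modulo
  \<open>E\<close>, subtracting multiples of \<open>v\<^sub>2\<close> moves vectors of \<open>C\<^sub>j\<close> into \<open>C\<^sub>j\<^sub>+\<^sub>1\<close>, up to torsion. That such a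
  \<open>t\<close> exists rests on \<open>finite_annihilator\<close>, which provides an \<open>r\<close> not
  annihilating \<open>V\<close> with \<open>w\<^sub>1 r \<in> C\<^sub>j\<close>.
\<close>

lemma dense_cyclic_extend:
  assumes E: "maximal_nondense E" and dense: "dense (cyclic w\<^sub>1 (shift_core E j))"
  shows "\<exists>w\<^sub>2. dense (cyclic w\<^sub>2 (shift_core E (Suc j)))"
proof (cases "\<exists>v\<in>shift_core E j. (X ^^ j) v \<notin> E")
  case False
  then have "shift_core E (Suc j) = shift_core E j" by (auto simp: shift_core_def less_Suc_eq)
  then show ?thesis using dense by metis
next
  case True
  then obtain v where v: "v \<in> shift_core E j" "(X ^^ j) v \<notin> E" by blast
  note sE = maximal_nondense_submodule[OF E]
  note sC = submodule_shift_core[OF sE]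
  define J where "J = {r. w\<^sub>1 \<cdot> r \<in> shift_core E j}"
  have J_right: "r * s \<in> J" if "r \<in> J" for r s
    using that submodule_act[OF sC] by (auto simp: J_def act_act[symmetric])
  obtain r where "r \<notin> annihilator" "\<forall>i<j. (X ^^ i) w\<^sub>1 \<cdot> r \<in> E"
    using finite_annihilator[OF E, of j "\<lambda>i. (X ^^ i) w\<^sub>1"] by blast
  then have r: "r \<in> J" "r \<notin> annihilator" by (auto simp: J_def shift_core_def Xn_act)
  obtain t s where t: "t \<in> shift_core E j" and s: "s \<in> J" and ts: "(X ^^ j) ((w\<^sub>1 + t) \<cdot> s) \<notin> E"
  proof (cases "\<exists>s\<in>J. (X ^^ j) (w\<^sub>1 \<cdot> s) \<notin> E")
    case True
    then show ?thesis using that[of 0] submodule_zero[OF sC] by auto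
  next
    case False
    obtain t s where t: "t \<in> shift_core E j" "s \<in> J" "(X ^^ j) (t \<cdot> s) \<notin> E"
      using separating_vector[OF E v J_right r] by blast
    have "(X ^^ j) (w\<^sub>1 \<cdot> s) \<in> E" using False t(2) by blast
    then have "(X ^^ j) ((w\<^sub>1 + t) \<cdot> s) \<notin> E"
      using submodule_diff[OF sE, of "(X ^^ j) ((w\<^sub>1 + t) \<cdot> s)" "(X ^^ j) (w\<^sub>1 \<cdot> s)"] t(3)
      by (auto simp: act_add_left Xn_add)
    then show ?thesis using that t by blast
  qed
  define w\<^sub>2 where "w\<^sub>2 = w\<^sub>1 + t"
  define v\<^sub>2 where "v\<^sub>2 = w\<^sub>2 \<cdot> s"
  have v2: "v\<^sub>2 \<in> shift_core E j"
    using s submodule_act[OF sC t] submodule_add[OF sC]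
    by (simp add: v\<^sub>2_def w\<^sub>2_def act_add_left J_def)
  have "(X ^^ j) v\<^sub>2 \<notin> E" using ts by (simp add: v\<^sub>2_def w\<^sub>2_def)
  from dense_cyclic[OF E this] have dense2: "dense (cyclic ((X ^^ j) v\<^sub>2) E)" .
  obtain w where w: "w \<notin> K" using nondegenerate by blast
  obtain p where "\<forall>q\<ge>p. (Y ^^ q) w \<in> cyclic w\<^sub>1 (shift_core E j)"
    using dense_Yn[OF w submodule_cyclic[OF sC] dense] by blast
  then have "\<forall>q. \<exists>r. q \<ge> p \<longrightarrow> (Y ^^ q) w - w\<^sub>1 \<cdot> r \<in> shift_core E j" by (auto simp: cyclic_def)
  then obtain \<rho> where \<rho>: "\<And>q. q \<ge> p \<Longrightarrow> (Y ^^ q) w - w\<^sub>1 \<cdot> \<rho> q \<in> shift_core E j" by metis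
  \<comment> \<open>Torsion exponents must be uniform; only the finitely many \<open>\<epsilon> q\<close> with \<open>p \<le> q \<le> p + n\<close> matter.\<close>
  define \<epsilon> where "\<epsilon> = (\<lambda>q. (Y ^^ q) w - w\<^sub>2 \<cdot> \<rho> q)"
  have \<epsilon>: "\<epsilon> q \<in> shift_core E j" if "q \<ge> p" for q
  proof -
    have "\<epsilon> q = ((Y ^^ q) w - w\<^sub>1 \<cdot> \<rho> q) - t \<cdot> \<rho> q"
      by (simp add: \<epsilon>_def w\<^sub>2_def act_add_left)
    then show ?thesis using submodule_diff[OF sC \<rho>[OF that] submodule_act[OF sC t]] by metis
  qed
  have "\<forall>q. \<exists>k. \<forall>c\<in>BP k. (X ^^ j) (\<epsilon> q) \<cdot> c \<in> cyclic ((X ^^ j) v\<^sub>2) E"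
    using dense2 unfolding dense_def by blast
  from choice[OF this] obtain k
    where k: "\<And>q c. c \<in> BP (k q) \<Longrightarrow> (X ^^ j) (\<epsilon> q) \<cdot> c \<in> cyclic ((X ^^ j) v\<^sub>2) E" by blast
  define l where "l = Max (k ` {..p + n})"
  have kl: "k q \<le> l" if "q \<le> p + n" for q using that by (simp add: l_def)
  have "dense (cyclic w\<^sub>2 (shift_core E (Suc j)))"
  proof (rule dense_if_Yn[OF w submodule_cyclic[OF sC]])
    fix q c assume q: "p \<le> q" "q \<le> p + n" and c: "c \<in> BP l"
    have "(X ^^ j) (\<epsilon> q) \<cdot> c \<in> cyclic ((X ^^ j) v\<^sub>2) E" by (intro k BP_antimono[OF kl[OF q(2)] c])
    then obtain r where "(X ^^ j) (\<epsilon> q) \<cdot> c - (X ^^ j) v\<^sub>2 \<cdot> r \<in> E" by (auto simp: cyclic_def)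
    then have "(X ^^ j) (\<epsilon> q \<cdot> c - v\<^sub>2 \<cdot> r) \<in> E" by (simp add: Xn_diff Xn_act)
    moreover have "\<epsilon> q \<cdot> c - v\<^sub>2 \<cdot> r \<in> shift_core E j"
      by (intro submodule_diff[OF sC] submodule_act[OF sC] \<epsilon> q v2)
    ultimately have "\<epsilon> q \<cdot> c - v\<^sub>2 \<cdot> r \<in> shift_core E (Suc j)"
      by (auto simp: shift_core_def less_Suc_eq)
    moreover have "(Y ^^ q) w \<cdot> c - w\<^sub>2 \<cdot> (\<rho> q * c + s * r) = \<epsilon> q \<cdot> c - v\<^sub>2 \<cdot> r"
      by (simp add: \<epsilon>_def v\<^sub>2_def act_diff_left act_add_right act_act)
    ultimately have "(Y ^^ q) w \<cdot> c - w\<^sub>2 \<cdot> (\<rho> q * c + s * r) \<in> shift_core E (Suc j)" by metis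
    then show "(Y ^^ q) w \<cdot> c \<in> cyclic w\<^sub>2 (shift_core E (Suc j))"
      unfolding cyclic_def by blast
  qed
  then show ?thesis by blast
qed

theorem algebraic_module_impossible: False
proof -
  obtain E where E: "maximal_nondense E" using maximal_nondense_exists by blast
  have "\<exists>w. dense (cyclic w (shift_core E j))" for j
  proof (induction j)
    case 0
    have "cyclic w (shift_core E 0) = UNIV" for w by (auto simp: cyclic_def shift_core_def)
    then show ?case by (simp add: dense_def)
  next
    case (Suc j)
    then show ?case using dense_cyclic_extend[OF E] by blast
  qed
  then obtain w where w: "dense (cyclic w K)" using shift_core_n[OF E] by metis
  show False
  proof (cases "w \<in> K")
    case True
    have "cyclic w K \<subseteq> K"
      using submodule_cong[OF submodule_self] K_act[OF True] by (auto simp: cyclic_def)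
    then show False using dense_superset[OF w] not_dense_K by blast
  next
    case False
    then show False using not_dense_cyclic w by blast
  qed
qed

end

theorem (in polynomial_module) leading_subset_annihilator: "leading n \<subseteq> annihilator"
proof (rule ccontr)
  assume "\<not> leading n \<subseteq> annihilator"
  then interpret algebraic_module act X K n
    by unfold_locales
  show False by (rule algebraic_module_impossible)
qed

section \<open>Maximal right ideals and polynomials\<close>

lemma quotient_jacobson_iff:
  assumes I: "two_sided_ideal I"
  shows "jacobson_radical_ring (quotient_ring I) \<longleftrightarrow> (\<forall>a. \<exists>r. a + r + a * r \<in> I)"
proof -
  interpret Q: nonunital_ring "quotient_ring I" by (rule nonunital_ring_quotient_ring[OF I])
  show ?thesis
    unfolding Q.jacobson_radical_ring_iff_quasi_regular
    by (simp add: quotient_ring_carrier[OF I] quotient_ring_add[OF I] quotient_ring_mult[OF I]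
        quotient_ring_zero[OF I] coset_eq_iff[OF I])
qed

text \<open>
  The ideal \<open>K\<close> is the preimage of a modular maximal right ideal of the quotient.
\<close>

lemma modular_maximal_right_ideal_exists:
  fixes I :: "'a::ring set"
  assumes I: "two_sided_ideal I" and not_radical: "\<not> jacobson_radical_ring (quotient_ring I)"
  obtains K e where "I \<subseteq> K" "K \<noteq> UNIV" "\<And>u v. u \<in> K \<Longrightarrow> v \<in> K \<Longrightarrow> u - v \<in> K"
    "\<And>u s. u \<in> K \<Longrightarrow> u * s \<in> K" "\<And>s. s - e * s \<in> K"
    "\<And>L. K \<subseteq> L \<Longrightarrow> (\<And>u v. u \<in> L \<Longrightarrow> v \<in> L \<Longrightarrow> u - v \<in> L) \<Longrightarrow>
      (\<And>u s. u \<in> L \<Longrightarrow> u * s \<in> L) \<Longrightarrow> L = K \<or> L = UNIV"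
proof -
  let ?Q = "quotient_ring I"
  interpret Q: nonunital_ring ?Q by (rule nonunital_ring_quotient_ring[OF I])
  define c where "c = (\<lambda>a. I +>\<^bsub>type_ring\<^esub> a)"
  have carrier: "carrier ?Q = range c"
    and add: "c a \<oplus>\<^bsub>?Q\<^esub> c b = c (a + b)"
    and mult: "c a \<otimes>\<^bsub>?Q\<^esub> c b = c (a * b)"
    and zero: "\<zero>\<^bsub>?Q\<^esub> = c 0"
    and eq_iff: "c a = c b \<longleftrightarrow> a - b \<in> I" for a b
    by (simp_all add: c_def quotient_ring_carrier[OF I] quotient_ring_add[OF I]
        quotient_ring_mult[OF I] quotient_ring_zero[OF I] coset_eq_iff[OF I])
  have minus: "\<ominus>\<^bsub>?Q\<^esub> c a = c (- a)" for a
    by (rule Q.minus_equality) (simp_all add: carrier add zero)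
  have diff: "c a \<ominus>\<^bsub>?Q\<^esub> c b = c (a - b)" for a b
    by (simp add: a_minus_def minus add)
  obtain M where modular: "modular_right_ideal M ?Q" and maximal: "maximal_right_ideal M ?Q"
    using not_radical unfolding jacobson_radical_ring_def jacobson_radical_def by blast
  have M: "right_ideal M ?Q" using modular by (simp add: modular_right_ideal_def)
  obtain e where e: "\<And>s. c s \<ominus>\<^bsub>?Q\<^esub> c e \<otimes>\<^bsub>?Q\<^esub> c s \<in> M"
    using modular unfolding modular_right_ideal_def carrier by blast
  define K where "K = {a. c a \<in> M}"
  have M_K: "M = c ` K"
    using M unfolding Q.right_ideal_iff carrier by (auto simp: K_def)
  have I_K: "I \<subseteq> K"
  proof
    fix a assume "a \<in> I"
    then have "c a = \<zero>\<^bsub>?Q\<^esub>" by (simp add: zero eq_iff)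
    then show "a \<in> K" using M by (simp add: K_def Q.right_ideal_iff)
  qed
  show thesis
  proof (rule that[of K e])
    show "I \<subseteq> K" by (rule I_K)
    show "K \<noteq> UNIV"
      using maximal unfolding maximal_right_ideal_def carrier M_K by blast
    show "u - v \<in> K" if "u \<in> K" "v \<in> K" for u v
      using M that by (simp add: K_def Q.right_ideal_iff diff[symmetric] a_minus_def)
    show "u * s \<in> K" if "u \<in> K" for u s
      using M that by (simp add: K_def Q.right_ideal_iff mult[symmetric] carrier)
    show "s - e * s \<in> K" for s
      using e[of s] by (simp add: K_def mult diff)
    show "L = K \<or> L = UNIV" if L: "K \<subseteq> L" "\<And>u v. u \<in> L \<Longrightarrow> v \<in> L \<Longrightarrow> u - v \<in> L"
      "\<And>u s. u \<in> L \<Longrightarrow> u * s \<in> L" for L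
    proof -
      have "0 \<in> L" using I I_K L(1) by (auto simp: two_sided_ideal_def)
      then have L_minus: "- u \<in> L" if "u \<in> L" for u using L(2)[of 0 u] that by simp
      have L_add: "u + v \<in> L" if "u \<in> L" "v \<in> L" for u v
        using L(2)[of u "- v"] L_minus that by simp
      have sat: "a \<in> L" if a: "c a \<in> c ` L" for a
      proof -
        obtain b where "b \<in> L" "a - b \<in> I" using a by (auto simp: eq_iff)
        then show ?thesis using L_add[of "a - b" b] I_K L(1) by auto
      qed
      have "right_ideal (c ` L) ?Q"
        unfolding Q.right_ideal_iff
        using \<open>0 \<in> L\<close> L_add L_minus L(3) by (auto simp: carrier zero add minus mult)
      moreover have "M \<subseteq> c ` L" using M_K L(1) by blast
      ultimately have "c ` L = M \<or> c ` L = range c"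
        using maximal unfolding maximal_right_ideal_def carrier by blast
      then show ?thesis
      proof
        assume "c ` L = M"
        then have "L \<subseteq> K" by (auto simp: K_def)
        then show ?thesis using L(1) by blast
      next
        assume "c ` L = range c"
        then have "a \<in> L" for a by (intro sat) simp
        then show ?thesis by blast
      qed
    qed
  qed
qed

text \<open>
  Multiplication by \<open>x\<close>, which is not an element of \<open>R[x]\<close> in the absence of an identity.
\<close>

lift_definition shift :: "(nat \<Rightarrow>\<^sub>0 'a::zero) \<Rightarrow> (nat \<Rightarrow>\<^sub>0 'a)" is
  "\<lambda>f k. case k of 0 \<Rightarrow> 0 | Suc m \<Rightarrow> f m"
proof -
  fix f :: "nat \<Rightarrow> 'a" assume "finite {m. f m \<noteq> 0}"
  then have "finite (Suc ` {m. f m \<noteq> 0})" by simp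
  moreover have "{k. (case k of 0 \<Rightarrow> 0 | Suc m \<Rightarrow> f m) \<noteq> 0} \<subseteq> Suc ` {m. f m \<noteq> 0}"
  proof
    fix k assume "k \<in> {k. (case k of 0 \<Rightarrow> 0 | Suc m \<Rightarrow> f m) \<noteq> 0}"
    then show "k \<in> Suc ` {m. f m \<noteq> 0}" by (cases k) auto
  qed
  ultimately show "finite {k. (case k of 0 \<Rightarrow> 0 | Suc m \<Rightarrow> f m) \<noteq> 0}"
    by (rule rev_finite_subset)
qed

lemma shift_add: "shift (p + q :: nat \<Rightarrow>\<^sub>0 'a::monoid_add) = shift p + shift q"
  by (rule poly_mapping_eqI) (simp add: shift.rep_eq lookup_add split: nat.splits)

lemma shift_zero [simp]: "shift 0 = 0"
  by (rule poly_mapping_eqI) (simp add: shift.rep_eq split: nat.splits)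

lemma shift_sum: "shift (sum f A :: nat \<Rightarrow>\<^sub>0 'a::comm_monoid_add) = (\<Sum>a\<in>A. shift (f a))"
  by (induction A rule: infinite_finite_induct) (simp_all add: shift_add)

lemma shift_single: "shift (Poly_Mapping.single k a) = Poly_Mapping.single (Suc k) a"
  by (rule poly_mapping_eqI) (auto simp: shift.rep_eq lookup_single when_def split: nat.splits)

lemma sum_single_lookup:
  fixes p :: "nat \<Rightarrow>\<^sub>0 'a::comm_monoid_add"
  assumes "Poly_Mapping.keys p \<subseteq> {..<d}"
  shows "p = (\<Sum>k<d. Poly_Mapping.single k (Poly_Mapping.lookup p k))"
proof (rule poly_mapping_eqI)
  fix m
  have "Poly_Mapping.lookup p m = 0" if "\<not> m < d"
    using assms that by (auto simp: in_keys_iff subset_iff)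
  then show "Poly_Mapping.lookup p m =
      Poly_Mapping.lookup (\<Sum>k<d. Poly_Mapping.single k (Poly_Mapping.lookup p k)) m"
    by (auto simp: lookup_sum lookup_single when_def sum.delta')
qed

lemma keys_bounded: "\<exists>d. Poly_Mapping.keys (p :: nat \<Rightarrow>\<^sub>0 'a::zero) \<subseteq> {..<d}"
  using finite_nat_set_iff_bounded[of "Poly_Mapping.keys p"] by auto

lemma
  fixes p q :: "nat \<Rightarrow>\<^sub>0 'a::ring"
  shows shift_mult_left: "shift p * q = shift (p * q)"
    and shift_mult_right: "p * shift q = shift (p * q)"
proof -
  obtain d e where d: "Poly_Mapping.keys p \<subseteq> {..<d}" and e: "Poly_Mapping.keys q \<subseteq> {..<e}"
    using keys_bounded by metis
  have "shift (\<Sum>k<d. Poly_Mapping.single k (Poly_Mapping.lookup p k)) *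
      (\<Sum>k<e. Poly_Mapping.single k (Poly_Mapping.lookup q k)) =
      shift ((\<Sum>k<d. Poly_Mapping.single k (Poly_Mapping.lookup p k)) *
        (\<Sum>k<e. Poly_Mapping.single k (Poly_Mapping.lookup q k)))"
    by (simp add: sum_product shift_sum shift_single mult_single)
  then show "shift p * q = shift (p * q)"
    by (simp only: sum_single_lookup[OF d, symmetric] sum_single_lookup[OF e, symmetric])
  have "(\<Sum>k<d. Poly_Mapping.single k (Poly_Mapping.lookup p k)) *
      shift (\<Sum>k<e. Poly_Mapping.single k (Poly_Mapping.lookup q k)) =
      shift ((\<Sum>k<d. Poly_Mapping.single k (Poly_Mapping.lookup p k)) *
        (\<Sum>k<e. Poly_Mapping.single k (Poly_Mapping.lookup q k)))"
    by (simp add: sum_product shift_sum shift_single mult_single)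
  then show "p * shift q = shift (p * q)"
    by (simp only: sum_single_lookup[OF d, symmetric] sum_single_lookup[OF e, symmetric])
qed

lemma mult_single_eq_shift:
  fixes v :: "nat \<Rightarrow>\<^sub>0 'a::ring"
  shows "v * Poly_Mapping.single k r = (shift ^^ k) (v * Poly_Mapping.single 0 r)"
  by (induction k) (simp_all add: shift_single[symmetric] shift_mult_right)

lemma mult_eq_sum_shift:
  fixes v p :: "nat \<Rightarrow>\<^sub>0 'a::ring"
  assumes "Poly_Mapping.keys p \<subseteq> {..<d}"
  shows "v * p = (\<Sum>k<d. (shift ^^ k) (v * Poly_Mapping.single 0 (Poly_Mapping.lookup p k)))"
proof -
  have "v * p = v * (\<Sum>k<d. Poly_Mapping.single k (Poly_Mapping.lookup p k))"
    using sum_single_lookup[OF assms] by metis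
  then show ?thesis
    unfolding sum_distrib_left using mult_single_eq_shift[of v] by (metis (no_types, lifting) sum.cong)
qed

text \<open>
  Modularity ensures that no nonzero vector of \<open>R[x] / K\<close> is annihilated by \<open>R[x]\<close>: the vectors
  that are form a right ideal, and if all were, \<open>e s\<close> and hence \<open>s\<close> would lie in \<open>K\<close> for every
  \<open>s\<close>. This is also why \<open>K\<close> is closed under multiplication by \<open>x\<close>.
\<close>

lemma polynomial_module_if_modular_maximal:
  fixes K :: "(nat \<Rightarrow>\<^sub>0 'a::ring) set"
  assumes nil: "nil_ring TYPE('a)" and proper: "K \<noteq> UNIV" and zero: "0 \<in> K"
    and diff: "\<And>u v. u \<in> K \<Longrightarrow> v \<in> K \<Longrightarrow> u - v \<in> K"
    and mult: "\<And>u s. u \<in> K \<Longrightarrow> u * s \<in> K" and modular: "\<And>s. s - e * s \<in> K"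
    and maximal: "\<And>L. K \<subseteq> L \<Longrightarrow> (\<And>u v. u \<in> L \<Longrightarrow> v \<in> L \<Longrightarrow> u - v \<in> L) \<Longrightarrow>
      (\<And>u s. u \<in> L \<Longrightarrow> u * s \<in> L) \<Longrightarrow> L = K \<or> L = UNIV"
  shows "polynomial_module (\<lambda>v r. v * Poly_Mapping.single 0 r) shift K"
proof -
  have add_closed: "u + v \<in> L"
    if "\<And>u v. u \<in> L \<Longrightarrow> v \<in> L \<Longrightarrow> u - v \<in> L" "u \<in> L" "v \<in> L"
    for L :: "(nat \<Rightarrow>\<^sub>0 'a) set" and u v
    using that(1)[OF that(2) that(1)[OF that(1)[OF that(3) that(3)] that(3)]] by simp
  have mult_closed: "u * s \<in> L"
    if L: "0 \<in> L" "\<And>u v. u \<in> L \<Longrightarrow> v \<in> L \<Longrightarrow> u - v \<in> L"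
      "\<And>v r. v \<in> L' \<Longrightarrow> v * Poly_Mapping.single 0 r \<in> L" "\<And>v. v \<in> L \<Longrightarrow> shift v \<in> L"
      and u: "u \<in> L'" for L L' :: "(nat \<Rightarrow>\<^sub>0 'a) set" and u s
  proof -
    obtain d where d: "Poly_Mapping.keys s \<subseteq> {..<d}" using keys_bounded by blast
    have shifts: "(shift ^^ k) v \<in> L" if "v \<in> L" for k v
      using that by (induction k) (auto intro: L(4))
    have "sum f A \<in> L" if "\<And>i. i \<in> A \<Longrightarrow> f i \<in> L" for f and A :: "nat set"
      using that
      by (induction A rule: infinite_finite_induct) (auto intro: L(1) add_closed L(2))
    then show ?thesis
      using shifts[OF L(3)[OF u]] by (simp add: mult_eq_sum_shift[OF d])
  qed
  have K_faithful: "v \<in> K" if "\<And>s. v * s \<in> K" for v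
  proof -
    let ?T = "{v. \<forall>s. v * s \<in> K}"
    have "?T = K \<or> ?T = UNIV"
      by (rule maximal) (auto simp: mult diff left_diff_distrib mult.assoc)
    moreover have "?T \<noteq> UNIV"
    proof
      assume "?T = UNIV"
      then have "s \<in> K" for s using add_closed[OF diff modular, of "e * s" s] by auto
      then show False using proper by blast
    qed
    ultimately show ?thesis using that by blast
  qed
  have K_shift: "shift v \<in> K" if "v \<in> K" for v
    by (rule K_faithful) (simp add: shift_mult_left shift_mult_right[symmetric] mult that)
  show ?thesis
  proof
    show "\<exists>v r. v * Poly_Mapping.single 0 r \<notin> K"
    proof (rule ccontr)
      assume "\<not> ?thesis"
      then have act: "v * Poly_Mapping.single 0 r \<in> K" for v r by blast
      have "v * s \<in> K" for v s
        by (rule mult_closed[of K UNIV, OF zero diff act K_shift UNIV_I])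
      then have "v \<in> K" for v by (rule K_faithful)
      then show False using proper by blast
    qed
    fix E :: "(nat \<Rightarrow>\<^sub>0 'a) set"
    assume E: "K \<subseteq> E" "\<And>u v. u \<in> E \<Longrightarrow> v \<in> E \<Longrightarrow> u - v \<in> E"
      "\<And>v r. v \<in> E \<Longrightarrow> v * Poly_Mapping.single 0 r \<in> E" "\<And>v. v \<in> E \<Longrightarrow> shift v \<in> E"
    show "E = K \<or> E = UNIV"
    proof (rule maximal)
      show "u * s \<in> E" if "u \<in> E" for u s
        by (rule mult_closed[of E E, OF subsetD[OF E(1) zero] E(2-4) that])
    qed (fact E)+
  qed (auto simp: nil zero diff mult K_shift distrib_left distrib_right single_add mult.assoc
      mult_single shift_add shift_mult_left)
qed

text \<open>
  An element \<open>p\<close> of \<open>I\<close> annihilates \<open>V\<close>. If one of its coefficients does not, the last such one is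
  the leading coefficient of an annihilating polynomial, because the terms of higher degree may be
  dropped. So all coefficients, and the ideal they generate, annihilate \<open>V\<close>.
\<close>

lemma coeff_ideal_poly_set_subset:
  fixes I K :: "(nat \<Rightarrow>\<^sub>0 'a::ring) set"
  assumes I: "two_sided_ideal I" "I \<subseteq> K"
    and module: "polynomial_module (\<lambda>v r. v * Poly_Mapping.single 0 r) shift K"
    and q: "q \<in> poly_set (coeff_ideal I)"
  shows "v * q \<in> K"
proof -
  let ?act = "\<lambda>v r. v * Poly_Mapping.single 0 r"
  interpret polynomial_module ?act shift K by (rule module)
  have coeff: "Poly_Mapping.lookup p i \<in> annihilator" if p: "p \<in> I" for p i
  proof (rule ccontr)
    let ?S = "{i. Poly_Mapping.lookup p i \<notin> annihilator}"
    assume i: "Poly_Mapping.lookup p i \<notin> annihilator"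
    obtain d where d: "Poly_Mapping.keys p \<subseteq> {..<d}" using keys_bounded by blast
    have zero: "0 \<in> annihilator" by (simp add: annihilator_def K_zero)
    have Sd: "?S \<subseteq> {..<d}"
    proof
      fix i assume "i \<in> ?S"
      then have "Poly_Mapping.lookup p i \<noteq> 0" using zero by auto
      then show "i \<in> {..<d}" using d by (auto simp: in_keys_iff)
    qed
    then have fin: "finite ?S" by (rule finite_subset) simp
    define n where "n = Max ?S"
    have n: "n \<in> ?S" unfolding n_def by (rule Max_in[OF fin]) (use i in blast)
    have above: "Poly_Mapping.lookup p k \<in> annihilator" if "n < k" for k
      using Max_ge[OF fin, of k] that by (auto simp: n_def)
    have "Poly_Mapping.lookup p n \<in> leading n"
      unfolding leading_def
    proof (intro CollectI exI allI)
      fix v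
      let ?f = "\<lambda>k. (shift ^^ k) (?act v (Poly_Mapping.lookup p k))"
      have "v * p \<in> K" using I p by (auto simp: two_sided_ideal_def)
      moreover have "v * p = (\<Sum>k<Suc n. ?f k) + (\<Sum>k\<in>{Suc n..<d}. ?f k)"
      proof -
        have "{..<d} = {..<Suc n} \<union> {Suc n..<d}" using n Sd by auto
        then show ?thesis
          unfolding mult_eq_sum_shift[OF d] by (metis (no_types, lifting) finite_lessThan
              finite_atLeastLessThan ivl_disj_int_one(2) sum.union_disjoint)
      qed
      moreover have "(\<Sum>k\<in>{Suc n..<d}. ?f k) \<in> K"
        using above by (intro submodule_sum[OF submodule_self] Xn_K) (auto simp: annihilator_def)
      ultimately have "(\<Sum>k<Suc n. ?f k) \<in> K"
        using K_diff[of "v * p" "\<Sum>k\<in>{Suc n..<d}. ?f k"] by simp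
      then show "?f n + (\<Sum>k<n. ?f k) \<in> K" by (simp add: add.commute)
    qed
    then show False using n leading_subset_annihilator by blast
  qed
  have "two_sided_ideal annihilator"
    unfolding two_sided_ideal_def annihilator_def
    by (auto simp: K_zero act_diff_right K_diff act_act[symmetric] K_act)
  then have "coeff_ideal I \<subseteq> annihilator"
    unfolding coeff_ideal_def using coeff by (intro hull_minimal) auto
  then have "?act v (Poly_Mapping.lookup q k) \<in> K" for k
    using q by (auto simp: poly_set_def annihilator_def)
  moreover obtain d where d: "Poly_Mapping.keys q \<subseteq> {..<d}" using keys_bounded by blast
  ultimately show ?thesis
    unfolding mult_eq_sum_shift[OF d] by (intro submodule_sum[OF submodule_self] Xn_K)
qed

section \<open>The equivalence\<close>

theorem theorem2:
  fixes I :: "(nat \<Rightarrow>\<^sub>0 'a::ring) set"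
  assumes "nil_ring TYPE('a)"
    and "two_sided_ideal I"
  shows "jacobson_radical_ring (quotient_ring I) \<longleftrightarrow>
         jacobson_radical_ring (quotient_ring (poly_set (coeff_ideal I)))"
proof
  let ?J = "poly_set (coeff_ideal I)"
  note J = two_sided_ideal_poly_set[OF two_sided_ideal_coeff_ideal[of I]]
  have "I \<subseteq> ?J"
    unfolding poly_set_def coeff_ideal_def by (auto intro: hull_inc)
  then show "jacobson_radical_ring (quotient_ring ?J)" if "jacobson_radical_ring (quotient_ring I)"
    using that quotient_jacobson_iff[OF assms(2)] quotient_jacobson_iff[OF J] by blast
  show "jacobson_radical_ring (quotient_ring I)" if "jacobson_radical_ring (quotient_ring ?J)"
  proof (rule ccontr)
    assume "\<not> jacobson_radical_ring (quotient_ring I)"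
    with assms(2) obtain K e where K: "I \<subseteq> K" "K \<noteq> UNIV"
      "\<And>u v. u \<in> K \<Longrightarrow> v \<in> K \<Longrightarrow> u - v \<in> K" "\<And>u s. u \<in> K \<Longrightarrow> u * s \<in> K"
      "\<And>s. s - e * s \<in> K"
      and maximal: "\<And>L. K \<subseteq> L \<Longrightarrow> (\<And>u v. u \<in> L \<Longrightarrow> v \<in> L \<Longrightarrow> u - v \<in> L) \<Longrightarrow>
      (\<And>u s. u \<in> L \<Longrightarrow> u * s \<in> L) \<Longrightarrow> L = K \<or> L = UNIV"
      by (rule modular_maximal_right_ideal_exists) blast
    have "0 \<in> K" using K(1) assms(2) by (auto simp: two_sided_ideal_def)
    then interpret polynomial_module "\<lambda>v r. v * Poly_Mapping.single 0 r" shift K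
      using polynomial_module_if_modular_maximal[OF assms(1) K(2) _ K(3-5) maximal] by blast
    have J_K: "q \<in> K" if "q \<in> ?J" for q
      using K_add[OF K(5)[of q]
          coeff_ideal_poly_set_subset[OF assms(2) K(1) polynomial_module_axioms that, of e]]
      by simp
    obtain r where "- e + r + (- e) * r \<in> ?J"
      using \<open>jacobson_radical_ring (quotient_ring ?J)\<close> quotient_jacobson_iff[OF J] by blast
    then have "- e + r + (- e) * r \<in> K" by (rule J_K)
    \<comment> \<open>Quasi-regularity of \<open>-e\<close> modulo \<open>K\<close> contradicts that \<open>e\<close> is a left identity modulo \<open>K\<close>.\<close>
    from K(3)[OF K(5)[of r] this] have "e \<in> K" by (simp add: algebra_simps)
    then have "s \<in> K" for s using K_add[OF K(5)[of s] K(4)[of e s]] by simp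
    then show False using K(2) by blast
  qed
qed

end
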